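(* Let $P_1$ and $P_2$ be 3-dimensional polytopes in $\mathbb{R}^3$, and let $P=P_1+P_2$ be their Minkowski sum. Then $$f_2(P)\leq f_0(P_1)f_0(P_2)+ f_0(P_1)+ f_0(P_2)-6,$$ $$f_1(P)\leq 2f_0(P_1)f_0(P_2)+ f_0(P_1)+ f_0(P_2)-8.$$ Moreover these bounds are tight: for all integers $n_1,n_2\ge 4$ there exist 3-dimensional polytopes $P_1,P_2\subset\mathbb{R}^3$ with $f_0(P_1)=n_1$, $f_0(P_2)=n_2$ for which both inequalities hold with equality.
   Context: $f_k(Q)$ is the number of $k$-dimensional faces of a polytope $Q$; $P_1+P_2=\{x+y: x\in P_1,\ y\in P_2\}$. *)

theory Defs
  imports "HOL-Analysis.Analysis" "HOL-Library.Set_Algebras"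
begin

(* face_of admits the empty set and the whole polytope as faces; the empty face
   has affine dimension -1, so it is never counted. *)
definition num_faces :: "nat \<Rightarrow> 'a::euclidean_space set \<Rightarrow> nat" where
  "num_faces k Q = card {F. F face_of Q \<and> aff_dim F = int k}"

definition polytope3 :: "(real^3) set \<Rightarrow> bool" where
  "polytope3 Q \<longleftrightarrow> polytope Q \<and> aff_dim Q = 3"

end

theory Submission
  imports Defs
begin

text \<open>A facet of \<open>P + Q\<close> is the sum of the faces of \<open>P\<close> and \<open>Q\<close> in the same outer normal direction.
  If neither of these is a facet, both are segments and the facet is a parallelogram. Hence the sum
  has at most \<open>f\<^sub>2(P) + f\<^sub>2(Q)\<close> triangular facets, where \<open>f\<^sub>2(P) \<le> 2 f\<^sub>0(P) - 4\<close> by Euler's formula. Every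
  edge lies in exactly two facets, so counting the vertices of all facets bounds the number of edges
  of the sum from below in terms of its facets. Euler's formula and \<open>f\<^sub>0(P + Q) \<le> f\<^sub>0(P) f\<^sub>0(Q)\<close> then
  yield both bounds. Equality holds when both summands are simplicial, in general position
  to each other, and every sum of two vertices is a vertex of the sum.\<close>

section \<open>Euler's formula\<close>

text \<open>Facets are indexed by their outer unit normals. The normals of \<open>P\<close>,
  \<open>Q\<close> and \<open>P + Q\<close> live in one space, so the facets of the sum split
  according to whether their normal belongs to a summand; a normal shared by both summands counts
  once. Write n, m for the vertex numbers. Counting facet vertices gives 4 f2 <= 2 f1 + f2(P) +
  f2(Q) for the sum, and f1 = f0 + f2 - 2 turns this into 2 f2 <= 2 f0 - 4 + f2(P) + f2(Q) <= 2nm +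
  2(n + m) - 12.

  For tightness all nm sums of vertices must survive. The points (i, 0, i^2) and (0, j, j^2) achieve
  this, as their sums lie on a paraboloid, but each of the two sets is planar. A cubic term of size
  \<epsilon> in the missing coordinate gives twisted cubics without four coplanar points, so the
  summands become solid and simplicial. For small \<epsilon> the facet normals of one summand are
  nearly orthogonal to the plane of its parabola; in such directions the points of the other curve
  have distinct heights, which is the general position required.\<close>

lemma polytope_slice:
  fixes P :: "'a::euclidean_space set"
  assumes "polytope P"
  shows "polytope (P \<inter> {x. c \<bullet> x = t})"
  by (simp add: assms polytope_Int_polyhedron polyhedron_hyperplane)

text \<open>The relative interior meets the hyperplane in a nonempty relatively open part of the
  affine section \<open>affine hull F \<inter> ?H\<close>, hence has the dimension of that section.
  The slice of \<open>F\<close> is squeezed between the two.\<close>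

lemma aff_dim_slice:
  fixes F :: "'a::euclidean_space set"
  assumes "rel_interior F \<inter> {x. c \<bullet> x = t} \<noteq> {}" and "\<not> F \<subseteq> {x. c \<bullet> x = t}"
  shows "aff_dim (F \<inter> {x. c \<bullet> x = t}) = aff_dim F - 1"
proof -
  let ?H = "{x. c \<bullet> x = t}"
  have "openin (top_of_set (affine hull F \<inter> ?H)) (rel_interior F \<inter> ?H)"
    using openin_rel_interior by (metis inf_commute openin_subtopology_Int subtopology_subtopology)
  then have "aff_dim (rel_interior F \<inter> ?H) = aff_dim (affine hull F \<inter> ?H)"
    using assms(1) by (intro aff_dim_openin) (auto simp: affine_Int affine_hyperplane)
  also have "\<dots> = aff_dim F - 1"
    using assms rel_interior_subset hull_subset[of F affine]
    by (subst aff_dim_affine_Int_hyperplane) (auto simp: subset_iff)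
  finally have "aff_dim (rel_interior F \<inter> ?H) = aff_dim F - 1"
    and "aff_dim (affine hull F \<inter> ?H) = aff_dim F - 1"
    using \<open>aff_dim (rel_interior F \<inter> ?H) = aff_dim (affine hull F \<inter> ?H)\<close> by auto
  moreover have "aff_dim (rel_interior F \<inter> ?H) \<le> aff_dim (F \<inter> ?H)"
    using rel_interior_subset by (intro aff_dim_subset) blast
  moreover have "aff_dim (F \<inter> ?H) \<le> aff_dim (affine hull F \<inter> ?H)"
    using hull_subset[of F affine] by (intro aff_dim_subset) blast
  ultimately show ?thesis by linarith
qed

text \<open>Take a face of least dimension containing \<open>x\<close>: if \<open>x\<close> were
  outside its relative interior, it would lie in a facet of that face, which is a smaller
  face.\<close>

lemma rel_interior_of_some_face:
  fixes P :: "'a::euclidean_space set"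
  assumes "polytope P" and "x \<in> P"
  obtains F where "F face_of P" "x \<in> rel_interior F"
proof -
  have "convex P" using assms by (simp add: polytope_imp_convex)
  let ?Q = "\<lambda>F. F face_of P \<and> x \<in> F"
  have "?Q P" using assms \<open>convex P\<close> by (simp add: face_of_refl)
  define F where "F = (ARG_MIN (\<lambda>F. nat (aff_dim F)) F. ?Q F)"
  have F: "?Q F" and min: "\<And>G. ?Q G \<Longrightarrow> nat (aff_dim F) \<le> nat (aff_dim G)"
    unfolding F_def using arg_min_nat_lemma[of ?Q P "\<lambda>F. nat (aff_dim F)"] \<open>?Q P\<close> by blast+
  have "polytope F" using F assms face_of_polytope_polytope by blast
  have "x \<in> rel_interior F"
  proof (rule ccontr)
    assume "x \<notin> rel_interior F"
    then obtain G where G: "G facet_of F" "x \<in> G"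
      using F rel_interior_of_polyhedron[OF polytope_imp_polyhedron[OF \<open>polytope F\<close>]] by blast
    then have "?Q G" using F face_of_trans facet_of_imp_face_of by blast
    moreover have "aff_dim G < aff_dim F" "0 \<le> aff_dim G"
      using G F aff_dim_negative_iff[of G] by (auto simp: facet_of_def simp flip: not_less)
    ultimately show False using min[OF \<open>?Q G\<close>] by simp
  qed
  with F that show thesis by blast
qed

lemma bij_betw_faces_slice:
  fixes P :: "'a::euclidean_space set"
  assumes P: "polytope P"
  shows "bij_betw (\<lambda>F. F \<inter> {x. c \<bullet> x = t})
           {F. F face_of P \<and> rel_interior F \<inter> {x. c \<bullet> x = t} \<noteq> {}}
           {G. G face_of (P \<inter> {x. c \<bullet> x = t}) \<and> G \<noteq> {}}"
proof -
  let ?H = "{x. c \<bullet> x = t}"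
  let ?A = "{F. F face_of P \<and> rel_interior F \<inter> ?H \<noteq> {}}"
  let ?B = "{G. G face_of (P \<inter> ?H) \<and> G \<noteq> {}}"
  have inj: "inj_on (\<lambda>F. F \<inter> ?H) ?A"
  proof -
    have "F \<subseteq> F'" if "F \<in> ?A" "F' \<in> ?A" "F \<inter> ?H = F' \<inter> ?H" for F F'
    proof (rule subset_of_face_of)
      show "F' face_of P" "F \<subseteq> P" using that face_of_imp_subset by auto
      show "F' \<inter> rel_interior F \<noteq> {}" using that rel_interior_subset by blast
    qed
    then show ?thesis by (intro inj_onI subset_antisym) simp_all
  qed
  have maps: "F \<inter> ?H \<in> ?B" if "F \<in> ?A" for F
    using that rel_interior_subset[of F] face_of_slice[of F P ?H]
    by (simp add: affine_hyperplane affine_imp_convex) blast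
  \<comment> \<open>The face to be cut is found from a relative interior point \<open>x\<close> of
    \<open>G\<close>: if \<open>x\<close> lies in the relative interior of \<open>F\<close>, then
    \<open>G\<close> and \<open>F \<inter> ?H\<close> are faces of the slice whose relative
    interiors share \<open>x\<close>, so they coincide.\<close>
  have surj: "\<exists>F\<in>?A. G = F \<inter> ?H" if G: "G face_of (P \<inter> ?H)" "G \<noteq> {}" for G
  proof -
    obtain x where x: "x \<in> rel_interior G"
      using G face_of_imp_convex rel_interior_eq_empty by blast
    then have xH: "x \<in> P" "x \<in> ?H"
      using G rel_interior_subset face_of_imp_subset by blast+
    then obtain F where F: "F face_of P" "x \<in> rel_interior F"
      using rel_interior_of_some_face[OF P] by blast
    then have "rel_interior (F \<inter> ?H) = rel_interior F \<inter> ?H"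
      using xH face_of_imp_convex by (intro convex_affine_rel_interior_Int) (auto simp: affine_hyperplane)
    then have "G = F \<inter> ?H"
      using x F xH
      by (intro face_of_eq[OF G(1) face_of_slice[OF F(1)]]) (auto simp: affine_hyperplane affine_imp_convex)
    with F xH show ?thesis by blast
  qed
  show ?thesis
  proof (rule bij_betw_imageI[OF inj], rule equalityI)
    show "(\<lambda>F. F \<inter> ?H) ` ?A \<subseteq> ?B" by (rule image_subsetI) (rule maps)
    show "?B \<subseteq> (\<lambda>F. F \<inter> ?H) ` ?A"
    proof
      fix G assume "G \<in> ?B"
      then have "\<exists>F\<in>?A. G = F \<inter> ?H" using surj by blast
      then show "G \<in> (\<lambda>F. F \<inter> ?H) ` ?A" by (rule image_iff[THEN iffD2])
    qed
  qed
qed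

section \<open>Faces crossed by a hyperplane\<close>

definition crosses :: "'a::euclidean_space \<Rightarrow> real \<Rightarrow> 'a set \<Rightarrow> bool" where
  "crosses c t F \<longleftrightarrow> (\<exists>x\<in>F. c \<bullet> x < t) \<and> (\<exists>x\<in>F. t < c \<bullet> x)"

text \<open>Forwards, a segment from a relative interior point to a point beyond the hyperplane
  stays in the relative interior up to its end. Backwards, if \<open>F\<close> lay on one side, its
  slice would be a face of \<open>F\<close> meeting the relative interior, hence all of
  \<open>F\<close>.\<close>

lemma crosses_iff:
  fixes F :: "'a::euclidean_space set"
  assumes "convex F"
  shows "crosses c t F \<longleftrightarrow>
    rel_interior F \<inter> {x. c \<bullet> x = t} \<noteq> {} \<and> \<not> F \<subseteq> {x. c \<bullet> x = t}"
proof
  assume "crosses c t F"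
  then obtain x y where xy: "x \<in> F" "c \<bullet> x < t" "y \<in> F" "t < c \<bullet> y" by (auto simp: crosses_def)
  obtain z where z: "z \<in> rel_interior F" using xy assms rel_interior_eq_empty by blast
  have *: "\<exists>u\<in>rel_interior F. c \<bullet> u = t" if "w \<in> F" "(c \<bullet> w - t) * (c \<bullet> z - t) < 0" for w
  proof -
    have "connected ((\<bullet>) c ` closed_segment z w)"
      by (intro connected_continuous_image continuous_intros) auto
    moreover have "c \<bullet> z \<in> (\<bullet>) c ` closed_segment z w" "c \<bullet> w \<in> (\<bullet>) c ` closed_segment z w" by auto
    moreover have "c \<bullet> z < t \<and> t < c \<bullet> w \<or> c \<bullet> w < t \<and> t < c \<bullet> z"
      using that by (auto simp: mult_less_0_iff)
    ultimately have "t \<in> (\<bullet>) c ` closed_segment z w"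
      using connectedD_interval[of "(\<bullet>) c ` closed_segment z w" "c \<bullet> z" "c \<bullet> w" t]
        connectedD_interval[of "(\<bullet>) c ` closed_segment z w" "c \<bullet> w" "c \<bullet> z" t] by linarith
    then obtain u where u: "u \<in> closed_segment z w" "c \<bullet> u = t" by auto
    moreover have "u \<noteq> z" "u \<noteq> w" using that u by auto
    ultimately have "u \<in> open_segment z w" by (simp add: open_segment_def)
    then have "u \<in> rel_interior F"
      using rel_interior_closure_convex_segment[OF assms z, of w] that closure_subset by blast
    with u show ?thesis by blast
  qed
  have "\<exists>u\<in>rel_interior F. c \<bullet> u = t"
  proof (cases "c \<bullet> z = t")
    case True then show ?thesis using z by blast
  next
    case False
    then consider "c \<bullet> z < t" | "t < c \<bullet> z" by linarith
    then show ?thesis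
    proof cases
      case 1 then show ?thesis using *[of y] xy by (simp add: mult_less_0_iff)
    next
      case 2 then show ?thesis using *[of x] xy by (simp add: mult_less_0_iff)
    qed
  qed
  moreover have "\<not> F \<subseteq> {x. c \<bullet> x = t}" using xy(1,2) by auto
  ultimately show "rel_interior F \<inter> {x. c \<bullet> x = t} \<noteq> {} \<and> \<not> F \<subseteq> {x. c \<bullet> x = t}" by blast
next
  assume R: "rel_interior F \<inter> {x. c \<bullet> x = t} \<noteq> {} \<and> \<not> F \<subseteq> {x. c \<bullet> x = t}"
  have "\<exists>x\<in>F. c \<bullet> x < t"
  proof (rule ccontr)
    assume "\<not> ?thesis"
    then have "\<And>x. x \<in> F \<Longrightarrow> c \<bullet> x \<ge> t" by (auto simp: not_less)
    then have "(F \<inter> {x. c \<bullet> x = t}) face_of F"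
      by (rule face_of_Int_supporting_hyperplane_ge[OF assms])
    then have "F \<subseteq> F \<inter> {x. c \<bullet> x = t}"
    proof (rule subset_of_face_of)
      show "F \<inter> {x. c \<bullet> x = t} \<inter> rel_interior F \<noteq> {}"
        using R rel_interior_subset[of F] by blast
    qed simp
    then show False using R by blast
  qed
  moreover have "\<exists>x\<in>F. t < c \<bullet> x"
  proof (rule ccontr)
    assume "\<not> ?thesis"
    then have "\<And>x. x \<in> F \<Longrightarrow> c \<bullet> x \<le> t" by (auto simp: not_less)
    then have "(F \<inter> {x. c \<bullet> x = t}) face_of F"
      by (rule face_of_Int_supporting_hyperplane_le[OF assms])
    then have "F \<subseteq> F \<inter> {x. c \<bullet> x = t}"
    proof (rule subset_of_face_of)
      show "F \<inter> {x. c \<bullet> x = t} \<inter> rel_interior F \<noteq> {}"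
        using R rel_interior_subset[of F] by blast
    qed simp
    then show False using R by blast
  qed
  ultimately show "crosses c t F" by (simp add: crosses_def)
qed

lemma exists_inner_nonzero:
  fixes D :: "'a::euclidean_space set"
  assumes "finite D" "0 \<notin> D"
  obtains c where "\<And>d. d \<in> D \<Longrightarrow> c \<bullet> d \<noteq> 0"
proof -
  have "\<exists>c. \<forall>d\<in>D. c \<bullet> d \<noteq> 0" using assms
  proof (induction D)
    case (insert d D)
    then obtain c where c: "\<forall>x\<in>D. c \<bullet> x \<noteq> 0" by auto
    \<comment> \<open>The values of \<open>s\<close> at which some inner product with
      \<open>c + s *\<^sub>R d\<close> can vanish. If \<open>d \<bullet> x = 0\<close>, the quotient
      is 0 and excludes one harmless value; there the product stays
      \<open>c \<bullet> x\<close>.\<close>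
    let ?B = "insert (- (c \<bullet> d) / (d \<bullet> d)) ((\<lambda>x. - (c \<bullet> x) / (d \<bullet> x)) ` D)"
    have "finite ?B" using insert by simp
    then obtain s where s: "s \<notin> ?B" using ex_new_if_finite infinite_UNIV_char_0 by blast
    have "(c + s *\<^sub>R d) \<bullet> x \<noteq> 0" if "x \<in> insert d D" for x
    proof
      assume *: "(c + s *\<^sub>R d) \<bullet> x = 0"
      have "d \<bullet> x \<noteq> 0"
        using * that c insert.prems by (cases "d \<bullet> x = 0") (auto simp: inner_add_left)
      then have "s = - (c \<bullet> x) / (d \<bullet> x)"
        using * by (simp add: inner_add_left field_simps)
      with s that show False by blast
    qed
    then show ?case by blast
  qed auto
  with that show thesis by blast
qed

section \<open>Signed counts of faces and their heights\<close>

abbreviation nonempty_faces :: "'a::euclidean_space set \<Rightarrow> 'a set set" where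
  "nonempty_faces P \<equiv> {F. F face_of P \<and> F \<noteq> {}}"

definition vertices :: "'a::euclidean_space set \<Rightarrow> 'a set" where
  "vertices P = {v. v extreme_point_of P}"

lemma vertices_subset: "vertices P \<subseteq> P"
  by (auto simp: vertices_def extreme_point_of_def)

definition dim_sign :: "'a::euclidean_space set \<Rightarrow> int" where
  "dim_sign F = (-1) ^ nat (aff_dim F)"

lemma finite_vertices: "polytope P \<Longrightarrow> finite (vertices P)"
  by (simp add: vertices_def finite_polyhedron_extreme_points polytope_imp_polyhedron)

lemma polytope_eq_hull_vertices:
  fixes P :: "'a::euclidean_space set"
  shows "polytope P \<Longrightarrow> P = convex hull vertices P"
  unfolding vertices_def by (intro Krein_Milman_Minkowski polytope_imp_compact polytope_imp_convex)

lemma vertices_nonempty: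
  fixes P :: "'a::euclidean_space set"
  assumes "polytope P" "P \<noteq> {}"
  shows "vertices P \<noteq> {}"
  using polytope_eq_hull_vertices[OF assms(1)] assms(2) by (metis convex_hull_empty)

lemma finite_nonempty_faces:
  fixes P :: "'a::euclidean_space set"
  shows "polytope P \<Longrightarrow> finite (nonempty_faces P)"
  by (rule finite_subset[OF _ finite_polytope_faces[of P]]) auto

text \<open>Taken over the finitely many vertices, so that the extreme heights of every face are
  among the heights at which the sweep passes a vertex.\<close>

definition lowest :: "'a::euclidean_space \<Rightarrow> 'a set \<Rightarrow> real" where
  "lowest c F = Min ((\<bullet>) c ` vertices F)"

definition highest :: "'a::euclidean_space \<Rightarrow> 'a set \<Rightarrow> real" where
  "highest c F = Max ((\<bullet>) c ` vertices F)"

lemma lowest_highest: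
  fixes F :: "'a::euclidean_space set"
  assumes "polytope F" "F \<noteq> {}"
  shows "lowest c F \<in> (\<bullet>) c ` vertices F" "highest c F \<in> (\<bullet>) c ` vertices F"
    and "\<And>x. x \<in> F \<Longrightarrow> lowest c F \<le> c \<bullet> x" "\<And>x. x \<in> F \<Longrightarrow> c \<bullet> x \<le> highest c F"
proof -
  let ?V = "vertices F"
  note fin = finite_vertices[OF assms(1)] and ne = vertices_nonempty[OF assms]
  show "lowest c F \<in> (\<bullet>) c ` ?V" "highest c F \<in> (\<bullet>) c ` ?V"
    unfolding lowest_def highest_def using fin ne by simp_all
  have "convex hull ?V \<subseteq> {x. c \<bullet> x \<ge> lowest c F}"
    unfolding lowest_def
  proof (intro hull_minimal subsetI convex_halfspace_ge)
    fix v assume "v \<in> ?V"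
    then show "v \<in> {x. c \<bullet> x \<ge> Min ((\<bullet>) c ` ?V)}" using fin by (simp add: Min_le)
  qed
  then show "lowest c F \<le> c \<bullet> x" if "x \<in> F" for x
    using polytope_eq_hull_vertices[OF assms(1)] that by auto
  have "convex hull ?V \<subseteq> {x. c \<bullet> x \<le> highest c F}"
    unfolding highest_def
  proof (intro hull_minimal subsetI convex_halfspace_le)
    fix v assume "v \<in> ?V"
    then show "v \<in> {x. c \<bullet> x \<le> Max ((\<bullet>) c ` ?V)}" using fin by (simp add: Max_ge)
  qed
  then show "c \<bullet> x \<le> highest c F" if "x \<in> F" for x
    using polytope_eq_hull_vertices[OF assms(1)] that by auto
qed

lemma crosses_iff_between:
  fixes F :: "'a::euclidean_space set"
  assumes "polytope F" "F \<noteq> {}"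
  shows "crosses c t F \<longleftrightarrow> lowest c F < t \<and> t < highest c F"
proof
  assume "crosses c t F"
  then obtain x y where "x \<in> F" "c \<bullet> x < t" "y \<in> F" "t < c \<bullet> y" by (auto simp: crosses_def)
  then show "lowest c F < t \<and> t < highest c F"
    using lowest_highest(3)[OF assms, of x c] lowest_highest(4)[OF assms, of y c] by linarith
next
  assume "lowest c F < t \<and> t < highest c F"
  moreover obtain v w where "v \<in> F" "lowest c F = c \<bullet> v" "w \<in> F" "highest c F = c \<bullet> w"
    using lowest_highest(1,2)[OF assms, of c] vertices_subset[of F] by blast
  ultimately show "crosses c t F" unfolding crosses_def by (metis)
qed

lemma vertices_face:
  fixes P :: "'a::euclidean_space set"
  shows "F face_of P \<Longrightarrow> vertices F = vertices P \<inter> F"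
  by (auto simp: vertices_def extreme_point_of_face)

text \<open>Distinct vertices have distinct heights, so a face of constant height has only one
  vertex.\<close>

lemma face_with_constant_height:
  fixes P :: "'a::euclidean_space set"
  assumes "polytope P" and inj: "inj_on ((\<bullet>) c) (vertices P)" and F: "F face_of P" "F \<noteq> {}"
    and const: "lowest c F = highest c F"
  obtains v where "v \<in> vertices P" "F = {v}"
proof -
  have pF: "polytope F" using assms face_of_polytope_polytope by blast
  have "c \<bullet> v = lowest c F" if "v \<in> vertices F" for v
    using lowest_highest(3,4)[OF pF F(2), of v c] that const vertices_subset[of F] by fastforce
  then have "v = w" if "v \<in> vertices F" "w \<in> vertices F" for v w
    using that inj vertices_face[OF F(1)] unfolding inj_on_def by (metis Int_iff)
  then obtain v where "vertices F = {v}" using vertices_nonempty[OF pF F(2)] by blast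
  then have "v \<in> vertices P" "F = {v}"
    using polytope_eq_hull_vertices[OF pF] vertices_face[OF F(1)] by auto
  then show thesis by (rule that)
qed

text \<open>The nonempty faces of the slice come from two kinds of faces of \<open>P\<close>. A
  crossed face loses one dimension, so its sign flips; a face inside the hyperplane keeps its sign,
  and as heights of vertices are distinct it can only be the one vertex at height \<open>t\<close>.
  Hence 1 is minus the wanted sum, plus 1 if \<open>t\<close> is a vertex height.\<close>

lemma euler_slice:
  fixes P :: "'a::euclidean_space set"
  assumes P: "polytope P" and inj: "inj_on ((\<bullet>) c) (vertices P)"
    and slice: "(\<Sum>G\<in>nonempty_faces (P \<inter> {x. c \<bullet> x = t}). dim_sign G) = 1"
  shows "(\<Sum>F | F \<in> nonempty_faces P \<and> crosses c t F. dim_sign F) =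
           (if t \<in> (\<bullet>) c ` vertices P then 1 else 0) - 1"
proof -
  let ?H = "{x. c \<bullet> x = t}"
  let ?A = "{F. F face_of P \<and> rel_interior F \<inter> ?H \<noteq> {}}"
  let ?C = "{F \<in> nonempty_faces P. crosses c t F}"
  let ?D = "{F \<in> nonempty_faces P. F \<subseteq> ?H}"
  have fin: "finite ?C" "finite ?D" by (rule finite_subset[OF _ finite_nonempty_faces[OF P]]; blast)+
  have conv: "convex F" if "F \<in> nonempty_faces P" for F
    using that face_of_imp_convex by blast
  have split: "?A = ?C \<union> ?D"
  proof (rule set_eqI)
    fix F
    show "F \<in> ?A \<longleftrightarrow> F \<in> ?C \<union> ?D"
    proof (cases "F \<in> nonempty_faces P")
      case True
      then have "rel_interior F \<noteq> {}" using conv rel_interior_eq_empty by blast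
      then have "F \<subseteq> ?H \<Longrightarrow> rel_interior F \<inter> ?H \<noteq> {}" using rel_interior_subset[of F] by blast
      then show ?thesis using crosses_iff[OF conv[OF True], of c t] True by blast
    qed auto
  qed
  have disj: "?C \<inter> ?D = {}" unfolding crosses_def by force
  have "1 = (\<Sum>F\<in>?A. dim_sign (F \<inter> ?H))"
    using slice sum.reindex_bij_betw[OF bij_betw_faces_slice[OF P], of dim_sign c t] by simp
  also have "\<dots> = (\<Sum>F\<in>?C. dim_sign (F \<inter> ?H)) + (\<Sum>F\<in>?D. dim_sign (F \<inter> ?H))"
    unfolding split using fin disj by (rule sum.union_disjoint)
  also have "(\<Sum>F\<in>?C. dim_sign (F \<inter> ?H)) = (\<Sum>F\<in>?C. - dim_sign F)"
  proof (rule sum.cong[OF refl])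
    fix F assume "F \<in> ?C"
    then have F: "F \<in> nonempty_faces P" and "crosses c t F" by auto
    then have ne: "rel_interior F \<inter> ?H \<noteq> {}" and "\<not> F \<subseteq> ?H"
      using crosses_iff[OF conv[OF F]] by blast+
    then have "aff_dim (F \<inter> ?H) = aff_dim F - 1" by (rule aff_dim_slice)
    moreover have "0 \<le> aff_dim (F \<inter> ?H)"
      using ne rel_interior_subset[of F] aff_dim_negative_iff[of "F \<inter> ?H"] by (simp flip: not_less) blast
    ultimately have "nat (aff_dim F) = Suc (nat (aff_dim (F \<inter> ?H)))" by linarith
    then show "dim_sign (F \<inter> ?H) = - dim_sign F" by (simp add: dim_sign_def)
  qed
  also have "(\<Sum>F\<in>?D. dim_sign (F \<inter> ?H)) = (if t \<in> (\<bullet>) c ` vertices P then 1 else 0)"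
  proof -
    have "?D = (\<lambda>v. {v}) ` {v \<in> vertices P. c \<bullet> v = t}"
    proof (intro equalityI subsetI)
      fix F assume "F \<in> ?D"
      then have F: "F face_of P" "F \<noteq> {}" "F \<subseteq> ?H" by auto
      have "polytope F" using P F face_of_polytope_polytope by blast
      then obtain v w where "v \<in> vertices F" "w \<in> vertices F" "lowest c F = c \<bullet> v" "highest c F = c \<bullet> w"
        using F(2) lowest_highest(1,2)[of F c] by blast
      moreover from this have "c \<bullet> v = t" "c \<bullet> w = t"
        using F(3) vertices_subset[of F] by blast+
      ultimately have "lowest c F = highest c F" by simp
      then obtain v where "v \<in> vertices P" "F = {v}"
        using face_with_constant_height[OF P inj F(1,2)] by blast
      with F show "F \<in> (\<lambda>v. {v}) ` {v \<in> vertices P. c \<bullet> v = t}" by auto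
    qed (auto simp: face_of_singleton vertices_def)
    moreover have "(\<Sum>F\<in>(\<lambda>v. {v}) ` {v \<in> vertices P. c \<bullet> v = t}. dim_sign (F \<inter> ?H))
        = (\<Sum>v | v \<in> vertices P \<and> c \<bullet> v = t. 1)"
      by (subst sum.reindex) (auto simp: dim_sign_def inj_on_def intro!: sum.cong)
    moreover have "(\<Sum>v | v \<in> vertices P \<and> c \<bullet> v = t. 1) = (if t \<in> (\<bullet>) c ` vertices P then 1 else (0::int))"
    proof (cases "t \<in> (\<bullet>) c ` vertices P")
      case True
      then obtain v where "v \<in> vertices P" "c \<bullet> v = t" by blast
      then have "{v. v \<in> vertices P \<and> c \<bullet> v = t} = {v}" using inj unfolding inj_on_def by blast
      with True show ?thesis by simp
    next
      case False
      then have "{v. v \<in> vertices P \<and> c \<bullet> v = t} = {}" by blast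
      with False show ?thesis by (metis sum.empty)
    qed
    ultimately show ?thesis by metis
  qed
  finally show ?thesis by (simp add: sum_negf)
qed

lemma exists_uniform_gap:
  fixes T :: "real set"
  assumes "finite T"
  obtains \<delta> where "\<delta> > 0" "\<And>h h'. h \<in> T \<Longrightarrow> h' \<in> T \<Longrightarrow> h' < h \<Longrightarrow> h' < h - \<delta>"
proof -
  let ?D = "{h - h' |h h'. h \<in> T \<and> h' \<in> T \<and> h' < h}"
  have "?D \<subseteq> (\<lambda>(h,h'). h - h') ` (T \<times> T)" by auto
  then have fin: "finite (insert 1 ?D)" using assms finite_subset by blast
  \<comment> \<open>The element 1 makes the minimum exist even if there are no two distinct heights;
    halving it below makes the gap strict.\<close>
  let ?m = "Min (insert 1 ?D)"
  have "?m > 0" using fin by (subst Min_gr_iff) auto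
  moreover have "h' < h - ?m / 2" if "h \<in> T" "h' \<in> T" "h' < h" for h h'
  proof -
    have "?m \<le> h - h'" using fin that by (intro Min_le) auto
    with \<open>?m > 0\<close> show ?thesis by linarith
  qed
  ultimately show thesis using that[of "?m / 2"] by simp
qed

text \<open>Sweep a hyperplane along a direction that separates the vertices. A face of positive dimension
  is met once more just below a vertex height than at a vertex height (in its interior), while
  by induction the signed number of faces crossed at a given level is known.\<close>
theorem euler_poincare:
  fixes P :: "'a::euclidean_space set"
  assumes "polytope P" "P \<noteq> {}"
  shows "(\<Sum>F\<in>nonempty_faces P. dim_sign F) = 1"
  using assms
proof (induction "nat (aff_dim P)" arbitrary: P rule: less_induct)
  case (less P)
  note P = less.prems
  let ?V = "vertices P" and ?F = "nonempty_faces P"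
  have finF: "finite ?F" by (rule finite_nonempty_faces[OF P(1)])
  have finV: "finite ?V" by (rule finite_vertices[OF P(1)])
  have "finite {v - w |v w. v \<in> ?V \<and> w \<in> ?V \<and> v \<noteq> w}"
    by (rule finite_subset[of _ "(\<lambda>(v,w). v - w) ` (?V \<times> ?V)"]) (use finV in auto)
  moreover have "0 \<notin> {v - w |v w. v \<in> ?V \<and> w \<in> ?V \<and> v \<noteq> w}" by auto
  ultimately obtain c where c: "\<And>d. d \<in> {v - w |v w. v \<in> ?V \<and> w \<in> ?V \<and> v \<noteq> w} \<Longrightarrow> c \<bullet> d \<noteq> 0"
    using exists_inner_nonzero by blast
  have inj: "inj_on ((\<bullet>) c) ?V"
  proof (rule inj_onI, rule ccontr)
    fix v w assume "v \<in> ?V" "w \<in> ?V" "c \<bullet> v = c \<bullet> w" "v \<noteq> w"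
    then show False using c[of "v - w"] by (auto simp: inner_diff_right)
  qed
  let ?T = "(\<bullet>) c ` ?V"
  have finT: "finite ?T" "?T \<noteq> {}" using finV vertices_nonempty[OF P] by auto
  obtain \<delta> where \<delta>: "\<delta> > 0" "\<And>h h'. h \<in> ?T \<Longrightarrow> h' \<in> ?T \<Longrightarrow> h' < h \<Longrightarrow> h' < h - \<delta>"
    using exists_uniform_gap[OF finT(1)] by metis
  define S where "S t = (\<Sum>F | F \<in> ?F \<and> crosses c t F. dim_sign F)" for t
  have S_cross: "S t = (if t \<in> ?T then 1 else 0) - 1" if t: "crosses c t P" for t
  proof -
    let ?Q = "P \<inter> {x. c \<bullet> x = t}"
    have H: "rel_interior P \<inter> {x. c \<bullet> x = t} \<noteq> {}" "\<not> P \<subseteq> {x. c \<bullet> x = t}"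
      using t crosses_iff[OF polytope_imp_convex[OF P(1)]] by blast+
    then have "aff_dim ?Q = aff_dim P - 1" by (rule aff_dim_slice)
    moreover have ne: "?Q \<noteq> {}" using H(1) rel_interior_subset[of P] by blast
    moreover have "aff_dim ?Q \<ge> 0" using ne aff_dim_negative_iff[of ?Q] by linarith
    ultimately have "nat (aff_dim ?Q) < nat (aff_dim P)" by linarith
    then have "(\<Sum>G\<in>nonempty_faces ?Q. dim_sign G) = 1"
      using less.hyps[of ?Q] ne polytope_slice[OF P(1)] by blast
    then show ?thesis unfolding S_def by (rule euler_slice[OF P(1) inj])
  qed
  have S_no_cross: "S t = 0" if "\<not> crosses c t P" for t
  proof -
    have "{F. F \<in> ?F \<and> crosses c t F} = {}"
      using that face_of_imp_subset unfolding crosses_def by blast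
    then show ?thesis unfolding S_def by (metis sum.empty)
  qed
  have pF: "polytope F" "F \<noteq> {}" if "F \<in> ?F" for F
    using that P face_of_polytope_polytope by auto
  have lohi: "lowest c F \<in> ?T" "highest c F \<in> ?T" if "F \<in> ?F" for F
    using lowest_highest(1,2)[OF pF[OF that], of c] vertices_face[of F P] that by auto
  let ?D = "{F \<in> ?F. lowest c F = highest c F}"
  let ?E = "{F \<in> ?F. lowest c F \<noteq> highest c F}"
  have D: "?D = (\<lambda>v. {v}) ` ?V"
  proof (intro equalityI subsetI)
    fix F assume "F \<in> ?D"
    then show "F \<in> (\<lambda>v. {v}) ` ?V" using face_with_constant_height[OF P(1) inj, of F] by blast
  qed (auto simp: face_of_singleton lowest_def highest_def vertices_def)
  then have sumD: "(\<Sum>F\<in>?D. dim_sign F) = int (card ?V)"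
    by (simp add: sum.reindex dim_sign_def)
  \<comment> \<open>Since no vertex height lies in \<open>[h - \<delta>, h)\<close>, the levels
    \<open>h - \<delta>\<close> and \<open>h\<close> differ for \<open>F\<close> only if
    \<open>h\<close> is its top: there \<open>F\<close> is crossed just below but not at
    \<open>h\<close>. At the bottom of \<open>F\<close> neither level crosses it. So each face that
    is not a vertex is counted exactly once.\<close>
  have one: "(\<Sum>h\<in>?T. of_bool (crosses c (h - \<delta>) F) - of_bool (crosses c h F)) = (1::int)"
    if F: "F \<in> ?E" for F
  proof -
    from F have F': "F \<in> ?F" and ne: "lowest c F \<noteq> highest c F" by auto
    have "lowest c F \<le> highest c F"
      using pF[OF F'] lowest_highest(3,4)[OF pF[OF F']] by (meson all_not_in_conv order_trans)
    with ne have lt: "lowest c F < highest c F" by simp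
    have "of_bool (crosses c (h - \<delta>) F) - of_bool (crosses c h F) = (if h = highest c F then 1 else (0::int))"
      if "h \<in> ?T" for h
    proof -
      have "lowest c F < h - \<delta> \<longleftrightarrow> lowest c F < h"
        using \<delta>(2)[OF that lohi(1)[OF F']] \<delta>(1) by linarith
      moreover have "h - \<delta> < highest c F \<longleftrightarrow> h \<le> highest c F"
        using \<delta>(2)[OF that lohi(2)[OF F']] \<delta>(1) by linarith
      ultimately show ?thesis using lt by (auto simp: crosses_iff_between[OF pF[OF F']])
    qed
    then have "(\<Sum>h\<in>?T. of_bool (crosses c (h - \<delta>) F) - of_bool (crosses c h F))
        = (\<Sum>h\<in>?T. if h = highest c F then 1 else (0::int))" by (intro sum.cong) auto
    also have "\<dots> = 1" using finT(1) lohi(2)[OF F'] by (simp only: sum.delta' sum.delta if_True)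
    finally show ?thesis .
  qed
  have S_alt: "S t = (\<Sum>F\<in>?E. dim_sign F * of_bool (crosses c t F))" for t
  proof -
    have "{F. F \<in> ?F \<and> crosses c t F} = {F \<in> ?E. crosses c t F}"
    proof -
      have "lowest c F \<noteq> highest c F" if "F \<in> ?F" "crosses c t F" for F
        using crosses_iff_between[OF pF[OF that(1)]] that(2) by force
      then show ?thesis by blast
    qed
    then have "S t = (\<Sum>F | F \<in> ?E \<and> crosses c t F. dim_sign F)" unfolding S_def by (rule sum.cong) simp
    also have "\<dots> = (\<Sum>F\<in>?E. if crosses c t F then dim_sign F else 0)"
      by (intro sum.inter_filter finite_subset[OF _ finF]) blast
    also have "\<dots> = (\<Sum>F\<in>?E. dim_sign F * of_bool (crosses c t F))"
      by (intro sum.cong) auto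
    finally show ?thesis .
  qed
  have "(\<Sum>F\<in>?E. dim_sign F) =
      (\<Sum>F\<in>?E. dim_sign F * (\<Sum>h\<in>?T. of_bool (crosses c (h - \<delta>) F) - of_bool (crosses c h F)))"
    by (rule sum.cong[OF refl], subst one) simp_all
  also have "\<dots> = (\<Sum>h\<in>?T. S (h - \<delta>) - S h)"
    unfolding sum_distrib_left S_alt
    by (subst sum.swap) (simp only: right_diff_distrib sum_subtractf)
  \<comment> \<open>At a vertex height \<open>S\<close> vanishes: either \<open>P\<close> is crossed
    and the terms 1 and -1 cancel, or the height is extreme and nothing is crossed. Just below it
    there is no vertex, so \<open>S\<close> is -1, except under the lowest vertex, where the
    hyperplane misses \<open>P\<close>.\<close>
  also have "\<dots> = (\<Sum>h\<in>?T. if h = Min ?T then 0 else - 1)"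
  proof (rule sum.cong[OF refl])
    fix h assume h: "h \<in> ?T"
    have S_h: "S h = 0" using S_cross[of h] S_no_cross[of h] h by (cases "crosses c h P") auto
    have cr: "crosses c (h - \<delta>) P \<longleftrightarrow> h \<noteq> Min ?T"
    proof -
      have lo: "lowest c P = Min ?T" and hi: "highest c P = Max ?T"
        by (simp_all add: lowest_def highest_def)
      have "Min ?T \<in> ?T" using finT by simp
      then have "Min ?T < h - \<delta> \<longleftrightarrow> Min ?T < h" using \<delta> h by (meson diff_strict_left_mono diff_gt_0_iff_gt less_trans diff_less_eq less_add_same_cancel1)
      moreover have "h - \<delta> < Max ?T" using finT h \<delta>(1) Max_ge[of ?T h] by linarith
      moreover have "Min ?T \<le> h" using finT h by simp
      ultimately show ?thesis unfolding crosses_iff_between[OF P] lo hi by linarith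
    qed
    have "h - \<delta> \<notin> ?T" using \<delta>(1) \<delta>(2)[OF h, of "h - \<delta>"] by auto
    then show "S (h - \<delta>) - S h = (if h = Min ?T then 0 else - 1)"
      using S_h cr S_cross[of "h - \<delta>"] S_no_cross[of "h - \<delta>"] by (cases "h = Min ?T") simp_all
  qed
  also have "\<dots> = - (int (card ?T) - 1)"
  proof -
    have "Min ?T \<in> ?T" using finT by simp
    then have "(\<Sum>h\<in>?T. if h = Min ?T then 0 else - 1) = (\<Sum>h\<in>?T - {Min ?T}. - 1 :: int)"
      using finT(1) by (subst sum.remove[of ?T "Min ?T"]) (auto intro!: sum.cong)
    also have "\<dots> = - int (card (?T - {Min ?T}))" by simp
    also have "\<dots> = - (int (card ?T) - 1)"
      using \<open>Min ?T \<in> ?T\<close> finT(1) card_Suc_Diff1[of ?T "Min ?T"] by linarith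
    finally show ?thesis .
  qed
  also have "card ?T = card ?V" using inj by (rule card_image)
  finally have sumE: "(\<Sum>F\<in>?E. dim_sign F) = 1 - int (card ?V)" by simp
  have "?F = ?D \<union> ?E" by blast
  then have "(\<Sum>F\<in>?F. dim_sign F) = (\<Sum>F\<in>?D. dim_sign F) + (\<Sum>F\<in>?E. dim_sign F)"
    using finF by (metis (no_types, lifting) sum.union_disjoint disjoint_iff finite_Un mem_Collect_eq)
  then show ?case using sumD sumE by simp
qed

section \<open>Euler's relation in terms of face numbers\<close>

lemma faces_of_dim_0:
  fixes P :: "'a::euclidean_space set"
  shows "{F. F face_of P \<and> aff_dim F = 0} = (\<lambda>v. {v}) ` vertices P"
  by (auto simp: vertices_def face_of_singleton aff_dim_eq_0)

lemma num_faces_0: "num_faces 0 P = card (vertices P)"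
  unfolding num_faces_def using faces_of_dim_0[of P] by (simp add: card_image)

lemma num_faces_full_dim:
  fixes P :: "'a::euclidean_space set"
  assumes "polytope P" "aff_dim P = int d"
  shows "num_faces d P = 1"
proof -
  have "convex P" using assms(1) by (rule polytope_imp_convex)
  then have "{F. F face_of P \<and> aff_dim F = int d} = {P}"
    using assms(2) face_of_aff_dim_lt[of P] face_of_refl[of P] by force
  then show ?thesis by (simp add: num_faces_def)
qed

corollary euler_num_faces:
  fixes P :: "'a::euclidean_space set"
  assumes P: "polytope P" and d: "aff_dim P = int d"
  shows "(\<Sum>k\<le>d. (-1) ^ k * int (num_faces k P)) = 1"
proof -
  have ne: "P \<noteq> {}" using d by auto
  have "(\<lambda>F. nat (aff_dim F)) ` nonempty_faces P \<subseteq> {..d}"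
    using d aff_dim_subset[OF face_of_imp_subset, of _ P] by force
  then have "(\<Sum>F\<in>nonempty_faces P. dim_sign F)
      = (\<Sum>k\<le>d. \<Sum>F | F \<in> nonempty_faces P \<and> nat (aff_dim F) = k. dim_sign F)"
    by (intro sum.group[symmetric] finite_nonempty_faces[OF P]) auto
  also have "\<dots> = (\<Sum>k\<le>d. (-1) ^ k * int (num_faces k P))"
  proof (rule sum.cong[OF refl])
    fix k
    have "{F. F \<in> nonempty_faces P \<and> nat (aff_dim F) = k} = {F. F face_of P \<and> aff_dim F = int k}"
    proof (intro Collect_cong iffI)
      fix F :: "'a set" assume "F \<in> nonempty_faces P \<and> nat (aff_dim F) = k"
      moreover from this have "0 \<le> aff_dim F" using aff_dim_negative_iff[of F] by (simp flip: not_less)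
      ultimately show "F face_of P \<and> aff_dim F = int k" by auto
    qed auto
    moreover have "(\<Sum>F | F face_of P \<and> aff_dim F = int k. dim_sign F)
        = (\<Sum>F | F face_of P \<and> aff_dim F = int k. (-1) ^ k)"
      by (rule sum.cong) (auto simp: dim_sign_def)
    ultimately show "(\<Sum>F | F \<in> nonempty_faces P \<and> nat (aff_dim F) = k. dim_sign F)
        = (-1) ^ k * int (num_faces k P)"
      by (simp add: num_faces_def)
  qed
  finally show ?thesis using euler_poincare[OF P ne] by simp
qed

text \<open>The relation reads f0 - f1 + 1 = 1. It lets the vertices of a facet be replaced by its
  edges when incidences are counted.\<close>

lemma euler_polygon:
  fixes F :: "'a::euclidean_space set"
  assumes "polytope F" "aff_dim F = 2"
  shows "num_faces 1 F = num_faces 0 F"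
  using euler_num_faces[of F 2] num_faces_full_dim[of F 2] assms
  by (simp add: numeral_2_eq_2)

lemma euler_polytope3:
  assumes "polytope3 P"
  shows "int (num_faces 0 P) - int (num_faces 1 P) + int (num_faces 2 P) = 2"
  using euler_num_faces[of P 3] num_faces_full_dim[of P 3] assms
  by (simp add: polytope3_def numeral_3_eq_3 numeral_2_eq_2)

lemma num_faces_0_ge:
  fixes P :: "'a::euclidean_space set"
  assumes "polytope P"
  shows "aff_dim P + 1 \<le> int (num_faces 0 P)"
proof -
  have "aff_dim P = aff_dim (vertices P)"
    using polytope_eq_hull_vertices[OF assms] aff_dim_convex_hull[of "vertices P"] by simp
  then show ?thesis
    using aff_dim_le_card[OF finite_vertices[OF assms]] by (simp add: num_faces_0)
qed

section \<open>Faces in a given direction\<close>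

text \<open>The support set of \<open>P\<close> in direction \<open>a\<close>. The maximal value is
  not a parameter, which makes the notion compatible with Minkowski sums.\<close>

definition mface :: "'a::euclidean_space set \<Rightarrow> 'a \<Rightarrow> 'a set" where
  "mface P a = {x \<in> P. \<forall>y\<in>P. a \<bullet> y \<le> a \<bullet> x}"

lemma mface_eq_slice:
  assumes "x \<in> mface P a"
  shows "mface P a = P \<inter> {y. a \<bullet> y = a \<bullet> x}"
  using assms unfolding mface_def by force

lemma mface_face_of:
  assumes "convex P"
  shows "mface P a face_of P"
proof (cases "mface P a = {}")
  case False
  then obtain x where x: "x \<in> mface P a" by blast
  then have "P \<inter> {y. a \<bullet> y = a \<bullet> x} face_of P"
    by (intro face_of_Int_supporting_hyperplane_le[OF assms]) (auto simp: mface_def)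
  then show ?thesis using mface_eq_slice[OF x] by simp
qed simp

lemma mface_nonempty:
  fixes P :: "'a::euclidean_space set"
  assumes "polytope P" "P \<noteq> {}"
  shows "mface P a \<noteq> {}"
proof -
  have "continuous_on P ((\<bullet>) a)" by (intro continuous_intros)
  then obtain x where "x \<in> P" "\<forall>y\<in>P. a \<bullet> y \<le> a \<bullet> x"
    using continuous_attains_sup[OF polytope_imp_compact[OF assms(1)] assms(2)] by blast
  then show ?thesis by (auto simp: mface_def)
qed

text \<open>The two summands vary independently, so a sum maximizes the functional only if both
  terms do.\<close>

lemma mface_plus: "mface (P + Q) a = mface P a + mface Q a"
proof (intro equalityI subsetI)
  fix x assume x: "x \<in> mface (P + Q) a"
  then obtain p q where pq: "p \<in> P" "q \<in> Q" "x = p + q" by (auto simp: mface_def set_plus_def)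
  have *: "a \<bullet> (p' + q') \<le> a \<bullet> (p + q)" if "p' \<in> P" "q' \<in> Q" for p' q'
    using x that pq(3) by (auto simp: mface_def set_plus_def)
  have "p \<in> mface P a" using *[OF _ pq(2)] pq(1) by (auto simp: mface_def inner_add_right)
  moreover have "q \<in> mface Q a" using *[OF pq(1)] pq(2) by (auto simp: mface_def inner_add_right)
  ultimately show "x \<in> mface P a + mface Q a" using pq(3) by auto
next
  fix x assume "x \<in> mface P a + mface Q a"
  then obtain p q where pq: "p \<in> mface P a" "q \<in> mface Q a" "x = p + q" by (auto elim: set_plus_elim)
  have "a \<bullet> y \<le> a \<bullet> x" if y: "y \<in> P + Q" for y
  proof -
    obtain p' q' where "p' \<in> P" "q' \<in> Q" "y = p' + q'" using y by (auto elim: set_plus_elim)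
    then show ?thesis using pq by (simp add: mface_def inner_add_right add_mono)
  qed
  then show "x \<in> mface (P + Q) a" using pq by (auto simp: mface_def)
qed

lemma polytope_mface: "polytope P \<Longrightarrow> polytope (mface P a)"
  by (meson face_of_polytope_polytope mface_face_of polytope_imp_convex)

lemma polytope_plus:
  fixes P Q :: "'a::euclidean_space set"
  assumes "polytope P" "polytope Q"
  shows "polytope (P + Q)"
  using assms unfolding polytope_def by (metis convex_hull_set_plus finite_set_plus)

lemma vertices_plus_subset:
  fixes P Q :: "'a::euclidean_space set"
  assumes "polytope P" "polytope Q"
  shows "vertices (P + Q) \<subseteq> vertices P + vertices Q"
proof -
  have "P + Q = convex hull (vertices P + vertices Q)"
    using assms by (metis convex_hull_set_plus polytope_eq_hull_vertices)
  then show ?thesis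
    using extreme_points_of_convex_hull[of "vertices P + vertices Q"] by (simp add: vertices_def)
qed

lemma num_faces_0_plus_le:
  fixes P Q :: "'a::euclidean_space set"
  assumes "polytope P" "polytope Q"
  shows "num_faces 0 (P + Q) \<le> num_faces 0 P * num_faces 0 Q"
proof -
  have fin: "finite (vertices P \<times> vertices Q)" using assms by (simp add: finite_vertices)
  have "vertices (P + Q) \<subseteq> (\<lambda>(x, y). x + y) ` (vertices P \<times> vertices Q)"
    using vertices_plus_subset[OF assms] by (simp add: set_plus_image)
  then have "card (vertices (P + Q)) \<le> card (vertices P \<times> vertices Q)"
    by (rule surj_card_le[OF fin])
  then show ?thesis by (simp add: num_faces_0 card_cartesian_product)
qed

text \<open>A segment around \<open>v + w\<close> splits into convex combinations in
  \<open>A\<close> and in \<open>B\<close>. By uniqueness of the decomposition they equal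
  \<open>v\<close> and \<open>w\<close>, so extremality makes both of them trivial.\<close>

lemma vertices_plus_inj:
  fixes A B :: "'a::euclidean_space set"
  assumes conv: "convex A" "convex B"
    and inj: "inj_on (\<lambda>(x, y). x + y) (A \<times> B)"
    and v: "v \<in> vertices A" and w: "w \<in> vertices B"
  shows "v + w \<in> vertices (A + B)"
proof -
  have vw: "v \<in> A" "w \<in> B" using v w vertices_subset by blast+
  have "v + w \<notin> open_segment x y" if xy: "x \<in> A + B" "y \<in> A + B" for x y
  proof
    assume "v + w \<in> open_segment x y"
    then obtain t where ne: "x \<noteq> y" and t: "0 < t" "t < 1" and eq: "v + w = (1 - t) *\<^sub>R x + t *\<^sub>R y"
      by (auto simp: in_segment)
    obtain a b where a: "a \<in> A" "b \<in> B" "x = a + b" using xy(1) by (auto elim: set_plus_elim)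
    obtain a' b' where a': "a' \<in> A" "b' \<in> B" "y = a' + b'" using xy(2) by (auto elim: set_plus_elim)
    let ?p = "(1 - t) *\<^sub>R a + t *\<^sub>R a'" and ?q = "(1 - t) *\<^sub>R b + t *\<^sub>R b'"
    have "?p \<in> A" "?q \<in> B" using conv a a' t by (auto intro!: convexD_alt)
    moreover have "v + w = ?p + ?q" using eq a(3) a'(3) by (simp add: algebra_simps)
    ultimately have "v = ?p" "w = ?q" using inj_onD[OF inj, of "(v, w)" "(?p, ?q)"] vw by auto
    then have "a \<noteq> a' \<Longrightarrow> v \<in> open_segment a a'" "b \<noteq> b' \<Longrightarrow> w \<in> open_segment b b'"
      using t unfolding in_segment by blast+
    then have "a = a'" "b = b'"
      using v w a a' by (auto simp: vertices_def extreme_point_of_def)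
    with ne a a' show False by simp
  qed
  then show ?thesis using vw by (auto simp: vertices_def extreme_point_of_def)
qed

lemma num_faces_0_plus_inj:
  fixes A B :: "'a::euclidean_space set"
  assumes "polytope A" "polytope B"
    and inj: "inj_on (\<lambda>(x, y). x + y) (A \<times> B)"
  shows "num_faces 0 (A + B) \<ge> num_faces 0 A * num_faces 0 B"
proof -
  have "(\<lambda>(x, y). x + y) ` (vertices A \<times> vertices B) \<subseteq> vertices (A + B)"
    using vertices_plus_inj[OF _ _ inj] assms polytope_imp_convex by auto
  moreover have "inj_on (\<lambda>(x, y). x + y) (vertices A \<times> vertices B)"
    by (rule inj_on_subset[OF inj]) (use vertices_subset in blast)
  moreover have "finite (vertices (A + B))" using assms by (intro finite_vertices polytope_plus)
  ultimately have "card (vertices A \<times> vertices B) \<le> card (vertices (A + B))"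
    by (metis card_inj_on_le)
  then show ?thesis by (simp add: num_faces_0 card_cartesian_product)
qed

text \<open>Faces of a polytope are exposed; scaling the exposing functional to unit length does not
  change where it is maximal.\<close>

lemma proper_face_eq_mface:
  fixes P :: "'a::euclidean_space set"
  assumes P: "polytope P" and F: "F face_of P" "F \<noteq> {}" "F \<noteq> P"
  obtains a where "norm a = 1" "F = mface P a"
proof -
  have "F exposed_face_of P"
    using exposed_face_of_polyhedron[OF polytope_imp_polyhedron[OF P]] F(1) by simp
  then obtain a b where a: "a \<noteq> 0" "P \<subseteq> {x. a \<bullet> x \<le> b}" "F = P \<inter> {x. a \<bullet> x = b}"
    using F(2,3) by (auto simp: exposed_face_of)
  obtain z where "z \<in> P" "a \<bullet> z = b" using F(2) a(3) by auto
  then have "F = mface P a" using a(2,3) unfolding mface_def by force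
  also have "mface P a = mface P (sgn a)"
    using a(1) by (simp add: mface_def sgn_div_norm divide_le_cancel)
  finally show thesis using that[of "sgn a"] a(1) by (simp add: norm_sgn)
qed

lemma aff_dim_plus_ge:
  fixes P Q :: "'a::euclidean_space set"
  assumes "Q \<noteq> {}"
  shows "aff_dim P \<le> aff_dim (P + Q)"
proof -
  obtain q where "q \<in> Q" using assms by blast
  then have "(+) q ` P \<subseteq> P + Q" by (auto simp: add.commute)
  then show ?thesis using aff_dim_subset[of "(+) q ` P"] by (simp add: aff_dim_translation_eq)
qed


text \<open>Unit length makes the outer normal of a facet unique, so that for a solid polytope this
  finite set stands for its set of facets.\<close>

definition normals :: "(real^3) set \<Rightarrow> (real^3) set" where
  "normals P = {a. norm a = 1 \<and> aff_dim (mface P a) = 2}"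

lemma aff_dim_mface_le:
  fixes a :: "real^3"
  assumes "a \<noteq> 0"
  shows "aff_dim (mface P a) \<le> 2"
proof -
  have "aff_dim (mface P a) \<le> aff_dim {x. a \<bullet> x = b}" if "mface P a \<subseteq> {x. a \<bullet> x = b}" for b
    using that by (rule aff_dim_subset)
  moreover have "\<exists>b. mface P a \<subseteq> {x. a \<bullet> x = b}"
  proof (cases "mface P a = {}")
    case False
    then obtain x where "x \<in> mface P a" by blast
    then have "mface P a \<subseteq> {y. a \<bullet> y = a \<bullet> x}" using mface_eq_slice[of x P a] by blast
    then show ?thesis by blast
  qed simp
  ultimately show ?thesis using assms by (auto simp: aff_dim_hyperplane)
qed

lemma hyperplane_facet_unique:
  fixes a b :: "real^3"
  assumes "norm a = 1" "norm b = 1" and F: "aff_dim F = 2"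
    and sub: "F \<subseteq> {x. a \<bullet> x = \<alpha>}" "F \<subseteq> {x. b \<bullet> x = \<beta>}"
  shows "a = b \<or> a = - b"
proof -
  have hull: "affine hull F = {x. c \<bullet> x = \<gamma>}" if "norm c = 1" "F \<subseteq> {x. c \<bullet> x = \<gamma>}" for c :: "real^3" and \<gamma>
  proof -
    have "c \<noteq> 0" using that by auto
    then have "aff_dim F = aff_dim {x. c \<bullet> x = \<gamma>}" using F by (simp add: aff_dim_hyperplane)
    then have "affine hull F = affine hull {x. c \<bullet> x = \<gamma>}" using aff_dim_eq_full_gen[OF that(2)] by simp
    then show ?thesis by (simp add: affine_hyperplane)
  qed
  then have eq: "{x. a \<bullet> x = \<alpha>} = {x. b \<bullet> x = \<beta>}" using assms by metis
  have "F \<noteq> {}" using F by auto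
  then obtain x where x: "a \<bullet> x = \<alpha>" "b \<bullet> x = \<beta>" using sub by blast
  \<comment> \<open>The component of \<open>b\<close> orthogonal to \<open>a\<close>. Moving along
    it stays in the common plane, so it is orthogonal to \<open>b\<close> as well and therefore
    zero.\<close>
  let ?u = "b - (a \<bullet> b) *\<^sub>R a"
  have aa: "a \<bullet> a = 1" using assms(1) by (simp add: norm_eq_1)
  then have au: "a \<bullet> ?u = 0" by (simp add: inner_diff_right)
  then have "x + ?u \<in> {x. a \<bullet> x = \<alpha>}" using x by (simp add: inner_add_right)
  then have "x + ?u \<in> {x. b \<bullet> x = \<beta>}" using eq by blast
  then have "b \<bullet> ?u = 0" using x by (simp add: inner_add_right)
  then have "?u \<bullet> ?u = 0" using au by (simp add: inner_diff_left)
  then have b: "b = (a \<bullet> b) *\<^sub>R a" by simp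
  then have "\<bar>a \<bullet> b\<bar> = 1" using assms by (metis mult.right_neutral norm_scaleR)
  then show ?thesis using b by (auto simp: abs_if split: if_splits)
qed

text \<open>The plane of a facet determines its unit normal up to sign, and opposite outer normals
  with a common maximal point would confine \<open>P\<close> to that plane.\<close>

lemma inj_on_mface_normals:
  assumes P: "polytope3 P"
  shows "inj_on (mface P) (normals P)"
proof (rule inj_onI)
  fix a b assume a: "a \<in> normals P" and b: "b \<in> normals P" and eq: "mface P a = mface P b"
  have "mface P a \<noteq> {}" using a by (auto simp: normals_def)
  then obtain x where x: "x \<in> mface P a" by blast
  have xb: "x \<in> mface P b" using x eq by simp
  have "mface P a \<subseteq> {y. a \<bullet> y = a \<bullet> x}" "mface P a \<subseteq> {y. b \<bullet> y = b \<bullet> x}"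
    using mface_eq_slice[OF x] mface_eq_slice[OF xb] eq by blast+
  then have "a = b \<or> a = - b"
    using a b by (intro hyperplane_facet_unique[of a b "mface P a"]) (auto simp: normals_def)
  moreover have "a \<noteq> - b"
  proof
    assume "a = - b"
    then have "P \<subseteq> mface P a" using x xb by (force simp: mface_def)
    then have "aff_dim P \<le> 2" using a aff_dim_subset[of P "mface P a"] by (simp add: normals_def)
    then show False using P by (simp add: polytope3_def)
  qed
  ultimately show "a = b" by blast
qed

lemma bij_betw_normals_facets:
  assumes P: "polytope3 P"
  shows "bij_betw (mface P) (normals P) {F. F face_of P \<and> aff_dim F = 2}"
proof (rule bij_betw_imageI[OF inj_on_mface_normals[OF P]], intro equalityI subsetI)
  have pP: "polytope P" "convex P" using P polytope_imp_convex by (auto simp: polytope3_def)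
  fix F
  show "F \<in> mface P ` normals P \<Longrightarrow> F \<in> {F. F face_of P \<and> aff_dim F = 2}"
    using mface_face_of[OF pP(2)] by (auto simp: normals_def)
  assume "F \<in> {F. F face_of P \<and> aff_dim F = 2}"
  then have F: "F face_of P" "aff_dim F = 2" by auto
  then have "F \<noteq> {}" "F \<noteq> P" using P by (auto simp: polytope3_def)
  then obtain a where "norm a = 1" "F = mface P a" using proper_face_eq_mface[OF pP(1) F(1)] by blast
  with F show "F \<in> mface P ` normals P" by (auto simp: normals_def)
qed

lemma finite_normals: "polytope3 P \<Longrightarrow> finite (normals P)"
  using bij_betw_finite[OF bij_betw_normals_facets[of P]]
    finite_subset[OF _ finite_polytope_faces[of P], of "{F. F face_of P \<and> aff_dim F = 2}"]
  by (auto simp: polytope3_def)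

lemma card_normals: "polytope3 P \<Longrightarrow> card (normals P) = num_faces 2 P"
  using bij_betw_same_card[OF bij_betw_normals_facets[of P]] by (simp add: num_faces_def)

section \<open>Facets through an edge\<close>

text \<open>Facet normals at \<open>x\<close> span extreme rays of the normal cone of
  \<open>P\<close> at \<open>x\<close>. On the facet of \<open>a\<close> the nonnegative slacks of
  \<open>b\<close> and \<open>c\<close>, weighted by \<open>s\<close> and \<open>t\<close>, add up
  to zero. A positive coefficient thus forces its slack to vanish there, which puts one facet inside
  another and makes them equal.\<close>

lemma normals_combination:
  assumes P: "polytope3 P" and N: "a \<in> normals P" "b \<in> normals P" "c \<in> normals P"
    and x: "x \<in> mface P a" "x \<in> mface P b" "x \<in> mface P c"
    and comb: "a = s *\<^sub>R b + t *\<^sub>R c" "0 \<le> s" "0 \<le> t"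
  shows "a = b \<or> a = c"
proof -
  have convP: "convex P" using P polytope_imp_convex by (auto simp: polytope3_def)
  have sub: "a = d" if d: "d \<in> normals P" and subset: "mface P a \<subseteq> mface P d" for d
  proof -
    have "mface P a face_of mface P d"
      using subset mface_face_of[OF convP] face_of_face by blast
    then have "mface P a = mface P d"
      using face_of_aff_dim_lt[of "mface P d" "mface P a"] N(1) d face_of_imp_convex[OF mface_face_of[OF convP]]
      by (force simp: normals_def)
    then show ?thesis using inj_on_mface_normals[OF P] N(1) d by (metis inj_onD)
  qed
  have max: "d \<bullet> y \<le> d \<bullet> x" if "y \<in> P" "x \<in> mface P d" for d y
    using that by (simp add: mface_def)
  have eq: "s * (b \<bullet> x - b \<bullet> y) + t * (c \<bullet> x - c \<bullet> y) = 0" if "y \<in> mface P a" for y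
    using that mface_eq_slice[OF x(1)] comb(1) by (auto simp: inner_add_left algebra_simps)
  have nonneg: "0 \<le> s * (b \<bullet> x - b \<bullet> y)" "0 \<le> t * (c \<bullet> x - c \<bullet> y)" if "y \<in> P" for y
    using comb(2,3) max[OF that x(2)] max[OF that x(3)] by simp_all
  have "a \<noteq> 0" using N(1) by (auto simp: normals_def)
  then consider "s > 0" | "t > 0" using comb by fastforce
  then show ?thesis
  proof cases
    case 1
    have "mface P a \<subseteq> mface P b"
    proof
      fix y assume y: "y \<in> mface P a"
      then have yP: "y \<in> P" by (simp add: mface_def)
      have "s * (b \<bullet> x - b \<bullet> y) = 0" using eq[OF y] nonneg[OF yP] by linarith
      then show "y \<in> mface P b" using 1 yP mface_eq_slice[OF x(2)] by auto
    qed
    then show ?thesis using sub N(2) by blast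
  next
    case 2
    have "mface P a \<subseteq> mface P c"
    proof
      fix y assume y: "y \<in> mface P a"
      then have yP: "y \<in> P" by (simp add: mface_def)
      have "t * (c \<bullet> x - c \<bullet> y) = 0" using eq[OF y] nonneg[OF yP] by linarith
      then show "y \<in> mface P c" using 2 yP mface_eq_slice[OF x(3)] by auto
    qed
    then show ?thesis using sub N(3) by blast
  qed
qed

text \<open>The normal cone at \<open>x\<close> is pointed: the weighted slacks of any point of
  \<open>P\<close> add up to zero, so the slack of \<open>a\<close> vanishes on all of
  \<open>P\<close>, which would then be flat.\<close>

lemma normals_no_nonneg_relation:
  assumes P: "polytope3 P" and N: "a \<in> normals P" "b \<in> normals P" "c \<in> normals P"
    and x: "x \<in> mface P a" "x \<in> mface P b" "x \<in> mface P c"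
    and rel: "r *\<^sub>R a + s *\<^sub>R b + t *\<^sub>R c = 0" "0 < r" "0 \<le> s" "0 \<le> t"
  shows False
proof -
  have "P \<subseteq> mface P a"
  proof
    fix y assume y: "y \<in> P"
    have "0 = (r *\<^sub>R a + s *\<^sub>R b + t *\<^sub>R c) \<bullet> (x - y)" using rel(1) by simp
    then have "0 = r * (a \<bullet> x - a \<bullet> y) + s * (b \<bullet> x - b \<bullet> y) + t * (c \<bullet> x - c \<bullet> y)"
      by (simp add: inner_add_left inner_diff_right algebra_simps)
    moreover have "0 \<le> r * (a \<bullet> x - a \<bullet> y)" "0 \<le> s * (b \<bullet> x - b \<bullet> y)" "0 \<le> t * (c \<bullet> x - c \<bullet> y)"
      using x y rel by (simp_all add: mface_def)
    ultimately have "r * (a \<bullet> x - a \<bullet> y) = 0" by linarith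
    then show "y \<in> mface P a" using rel(2) y mface_eq_slice[OF x(1)] by auto
  qed
  then have "aff_dim P \<le> 2" using N(1) aff_dim_subset[of P "mface P a"] by (simp add: normals_def)
  then show False using P by (simp add: polytope3_def)
qed

text \<open>In a nontrivial linear relation between three vectors, up to an overall sign either all
  coefficients are nonnegative or exactly one is negative.\<close>
lemma normals_independent:
  assumes P: "polytope3 P" and N: "a \<in> normals P" "b \<in> normals P" "c \<in> normals P"
    and x: "x \<in> mface P a" "x \<in> mface P b" "x \<in> mface P c"
    and ne: "a \<noteq> b" "a \<noteq> c" "b \<noteq> c"
    and rel: "r *\<^sub>R a + s *\<^sub>R b + t *\<^sub>R c = 0"
  shows "r = 0 \<and> s = 0 \<and> t = 0"
proof -
  have solve: False if N: "a \<in> normals P" "b \<in> normals P" "c \<in> normals P"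
    and x: "x \<in> mface P a" "x \<in> mface P b" "x \<in> mface P c"
    and ne: "a \<noteq> b" "a \<noteq> c" and rel: "r *\<^sub>R a + s *\<^sub>R b + t *\<^sub>R c = 0" "r \<noteq> 0" "r * s \<le> 0" "r * t \<le> 0"
  for a b c r s t
  proof -
    have "r *\<^sub>R a = (- s) *\<^sub>R b + (- t) *\<^sub>R c" using rel(1) by (simp add: eq_neg_iff_add_eq_0 add.assoc algebra_simps)
    then have "(1 / r) *\<^sub>R (r *\<^sub>R a) = (1 / r) *\<^sub>R ((- s) *\<^sub>R b + (- t) *\<^sub>R c)" by simp
    then have "a = (- s / r) *\<^sub>R b + (- t / r) *\<^sub>R c"
      using rel(2) by (simp add: scaleR_add_right scaleR_diff_right)
    moreover have "0 \<le> - s / r" "0 \<le> - t / r"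
      using rel(2-) by (auto simp: zero_le_divide_iff mult_le_0_iff divide_le_0_iff)
    ultimately show False using normals_combination[OF P N x] ne by blast
  qed
  have nonneg: False if N: "a \<in> normals P" "b \<in> normals P" "c \<in> normals P"
    and x: "x \<in> mface P a" "x \<in> mface P b" "x \<in> mface P c"
    and rel: "r *\<^sub>R a + s *\<^sub>R b + t *\<^sub>R c = 0" "r \<noteq> 0" "0 \<le> r * s" "0 \<le> r * t" for a b c r s t
  proof -
    \<comment> \<open>Multiplying the relation by \<open>r\<close> makes the first coefficient
      positive and the others nonnegative, whatever the common sign was.\<close>
    have "(r * r) *\<^sub>R a + (r * s) *\<^sub>R b + (r * t) *\<^sub>R c = r *\<^sub>R (r *\<^sub>R a + s *\<^sub>R b + t *\<^sub>R c)"
      by (simp add: scaleR_add_right)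
    then have "(r * r) *\<^sub>R a + (r * s) *\<^sub>R b + (r * t) *\<^sub>R c = 0" using rel(1) by simp
    moreover have "0 < r * r" using rel(2) by (metis not_real_square_gt_zero)
    ultimately show False using normals_no_nonneg_relation[OF P N x] rel by blast
  qed
  have perm: "s *\<^sub>R b + r *\<^sub>R a + t *\<^sub>R c = 0" "t *\<^sub>R c + r *\<^sub>R a + s *\<^sub>R b = 0"
    using rel by (simp_all add: add_ac)
  note A = solve[OF N x ne(1,2) rel] solve[OF N(2,1,3) x(2,1,3) ne(1)[symmetric] ne(3) perm(1)]
    solve[OF N(3,1,2) x(3,1,2) ne(2,3)[symmetric] perm(2)]
  note B = nonneg[OF N x rel] nonneg[OF N(2,1,3) x(2,1,3) perm(1)] nonneg[OF N(3,1,2) x(3,1,2) perm(2)]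
  show ?thesis
  proof (rule ccontr)
    assume nz: "\<not> ?thesis"
    consider "r \<noteq> 0" "r * s \<le> 0" "r * t \<le> 0" | "s \<noteq> 0" "s * r \<le> 0" "s * t \<le> 0"
      | "t \<noteq> 0" "t * r \<le> 0" "t * s \<le> 0" | "r \<noteq> 0" "0 \<le> r * s" "0 \<le> r * t"
      | "s \<noteq> 0" "0 \<le> s * r" "0 \<le> s * t" | "t \<noteq> 0" "0 \<le> t * r" "0 \<le> t * s"
      using nz by (cases r "0::real" rule: linorder_cases; cases s "0::real" rule: linorder_cases;
          cases t "0::real" rule: linorder_cases) (auto simp: mult_le_0_iff zero_le_mult_iff)
    then show False
    proof cases
      case 1 then show ?thesis by (rule A(1))
    next
      case 2 then show ?thesis by (rule A(2))
    next
      case 3 then show ?thesis by (rule A(3))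
    next
      case 4 then show ?thesis by (rule B(1))
    next
      case 5 then show ?thesis by (rule B(2))
    next
      case 6 then show ?thesis by (rule B(3))
    qed
  qed
qed

lemma three_orthogonal_dependent:
  fixes a b c d :: "real^3"
  assumes "d \<noteq> 0" "d \<bullet> a = 0" "d \<bullet> b = 0" "d \<bullet> c = 0" and ne: "a \<noteq> b" "a \<noteq> c" "b \<noteq> c"
  obtains r s t where "r *\<^sub>R a + s *\<^sub>R b + t *\<^sub>R c = 0" "\<not> (r = 0 \<and> s = 0 \<and> t = 0)"
proof -
  have "dependent {a, b, c}"
  proof (rule ccontr)
    assume "independent {a, b, c}"
    then have "card {a, b, c} \<le> dim {x. d \<bullet> x = 0}"
      using assms by (intro independent_card_le_dim) auto
    then show False using assms by (simp add: dim_hyperplane)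
  qed
  then obtain u where u: "\<exists>v\<in>{a, b, c}. u v \<noteq> 0" "(\<Sum>v\<in>{a, b, c}. u v *\<^sub>R v) = 0"
    by (auto simp: dependent_finite)
  show thesis
  proof (rule that[of "u a" "u b" "u c"])
    show "u a *\<^sub>R a + u b *\<^sub>R b + u c *\<^sub>R c = 0" using u(2) ne by (simp add: add.assoc)
  qed (use u(1) in auto)
qed

text \<open>A proper nonempty face is the intersection of the facets containing it. No such facet
  would give the whole space and a single one would give a facet, so there are at least two. Three
  of them would have normals orthogonal to the edge, hence dependent, although distinct facet
  normals at a common point are independent.\<close>

lemma card_facets_through_edge:
  assumes P: "polytope3 P" and e: "e face_of P" "aff_dim e = 1"
  shows "card {a \<in> normals P. e \<subseteq> mface P a} = 2"
proof -
  let ?N = "{a \<in> normals P. e \<subseteq> mface P a}"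
  have pP: "polytope P" using P by (simp add: polytope3_def)
  have fin: "finite ?N" using finite_normals[OF P] by simp
  have ne: "e \<noteq> {}" "e \<noteq> P" using e P by (auto simp: polytope3_def)
  have facet: "F facet_of P \<longleftrightarrow> F face_of P \<and> aff_dim F = 2" for F
    using P by (auto simp: facet_of_def polytope3_def)
  have bij: "mface P ` normals P = {F. F face_of P \<and> aff_dim F = 2}"
    using bij_betw_normals_facets[OF P] by (rule bij_betw_imp_surj_on)
  have "{F. F facet_of P \<and> e \<subseteq> F} = {F \<in> {F. F face_of P \<and> aff_dim F = 2}. e \<subseteq> F}"
    by (simp add: facet)
  also have "\<dots> = {F \<in> mface P ` normals P. e \<subseteq> F}" by (simp only: bij)
  also have "\<dots> = mface P ` ?N" by blast
  finally have "{F. F facet_of P \<and> e \<subseteq> F} = mface P ` ?N" .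
  then have e_eq: "e = \<Inter> (mface P ` ?N)"
    using face_of_polyhedron[OF polytope_imp_polyhedron[OF pP] e(1) ne] by simp
  have "card ?N \<noteq> 0"
  proof
    assume "card ?N = 0"
    then have "?N = {}" using fin by (simp only: card_0_eq)
    then have "e = \<Inter> (mface P ` {})" using e_eq by metis
    then have "e = UNIV" by simp
    then show False using e(2) by simp
  qed
  moreover have "card ?N \<noteq> 1"
  proof
    assume "card ?N = 1"
    then obtain a where "?N = {a}" by (rule card_1_singletonE)
    then have "e = mface P a" "a \<in> normals P" using e_eq by auto
    then show False using e(2) by (simp add: normals_def)
  qed
  moreover have "\<not> 3 \<le> card ?N"
  proof
    assume "3 \<le> card ?N"
    then obtain M where M: "M \<subseteq> ?N" "card M = 3" by (rule obtain_subset_with_card_n)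
    obtain a b c where abc: "M = {a, b, c}" "a \<noteq> b" "a \<noteq> c" "b \<noteq> c"
      using iffD1[OF card_3_iff M(2)] by blast
    then have abcN: "a \<in> ?N" "b \<in> ?N" "c \<in> ?N" using M(1) by blast+
    obtain x y where xy: "x \<in> e" "y \<in> e" "x \<noteq> y"
    proof -
      obtain x where "x \<in> e" using ne by blast
      moreover have "e \<noteq> {x}" using e(2) by auto
      ultimately show thesis using that by blast
    qed
    have orth: "(y - x) \<bullet> d = 0" if "d \<in> ?N" for d
    proof -
      have "x \<in> mface P d" "y \<in> mface P d" using that xy by auto
      then have "d \<bullet> y = d \<bullet> x" using mface_eq_slice[of x P d] by auto
      then show ?thesis by (simp add: inner_diff_left inner_diff_right inner_commute)
    qed
    obtain r s t where "r *\<^sub>R a + s *\<^sub>R b + t *\<^sub>R c = 0" "\<not> (r = 0 \<and> s = 0 \<and> t = 0)"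
      using three_orthogonal_dependent[of "y - x" a b c, OF _ orth orth orth] abc(2-) abcN xy(3)
      by (metis right_minus_eq)
    moreover have "x \<in> mface P a" "x \<in> mface P b" "x \<in> mface P c"
      "a \<in> normals P" "b \<in> normals P" "c \<in> normals P" using abcN xy(1) by blast+
    ultimately show False using normals_independent[OF P _ _ _ _ _ _ abc(2-4)] by blast
  qed
  ultimately show ?thesis by linarith
qed

text \<open>A facet is a polygon and has as many vertices as edges, so the sum counts incidences of
  edges and facets; each edge contributes two.\<close>

lemma sum_facet_vertices:
  assumes P: "polytope3 P"
  shows "(\<Sum>a\<in>normals P. num_faces 0 (mface P a)) = 2 * num_faces 1 P"
proof -
  let ?E = "{e. e face_of P \<and> aff_dim e = 1}"
  have pP: "polytope P" "convex P" using P polytope_imp_convex by (auto simp: polytope3_def)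
  have fin: "finite ?E" by (rule finite_subset[OF _ finite_polytope_faces[OF pP(1)]]) auto
  have "num_faces 0 (mface P a) = card {e \<in> ?E. e \<subseteq> mface P a}" if "a \<in> normals P" for a
  proof -
    have "num_faces 0 (mface P a) = num_faces 1 (mface P a)"
      using that polytope_mface[OF pP(1)] by (intro euler_polygon[symmetric]) (auto simp: normals_def)
    moreover have "{e. e face_of mface P a \<and> aff_dim e = int 1} = {e \<in> ?E. e \<subseteq> mface P a}"
      using face_of_face[OF mface_face_of[OF pP(2)]] by auto
    ultimately show ?thesis by (simp add: num_faces_def)
  qed
  then have "(\<Sum>a\<in>normals P. num_faces 0 (mface P a)) = (\<Sum>a\<in>normals P. card {e \<in> ?E. e \<subseteq> mface P a})"
    by (rule sum.cong[OF refl])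
  also have "\<dots> = 2 * card ?E"
    by (rule sum_multicount[OF finite_normals[OF P] fin]) (use card_facets_through_edge[OF P] in blast)
  finally show ?thesis by (simp add: num_faces_def)
qed

lemma facet_vertices_ge_3:
  assumes "polytope3 P" "a \<in> normals P"
  shows "num_faces 0 (mface P a) \<ge> 3"
  using num_faces_0_ge[OF polytope_mface, of P a] assms by (simp add: polytope3_def normals_def)

text \<open>Facets have at least three vertices, so 3 f2 <= 2 f1, and Euler's formula eliminates
  f1.\<close>

lemma num_faces_2_le:
  assumes P: "polytope3 P"
  shows "int (num_faces 2 P) \<le> 2 * int (num_faces 0 P) - 4"
proof -
  have "3 * num_faces 2 P = (\<Sum>a\<in>normals P. 3)" by (simp add: card_normals[OF P])
  also have "\<dots> \<le> 2 * num_faces 1 P"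
    unfolding sum_facet_vertices[OF P, symmetric] by (rule sum_mono) (rule facet_vertices_ge_3[OF P])
  finally show ?thesis using euler_polytope3[OF P] by linarith
qed

lemma num_faces_2_simplicial:
  assumes P: "polytope3 P" and "\<And>a. a \<in> normals P \<Longrightarrow> num_faces 0 (mface P a) = 3"
  shows "int (num_faces 2 P) = 2 * int (num_faces 0 P) - 4"
proof -
  have "2 * num_faces 1 P = (\<Sum>a\<in>normals P. 3)"
    unfolding sum_facet_vertices[OF P, symmetric] using assms(2) by (rule sum.cong[OF refl])
  also have "\<dots> = 3 * num_faces 2 P" by (simp add: card_normals[OF P])
  finally show ?thesis using euler_polytope3[OF P] by linarith
qed

section \<open>The bounds\<close>

lemma polytope3_plus:
  assumes "polytope3 P" "polytope3 Q"
  shows "polytope3 (P + Q)"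
proof -
  have "Q \<noteq> {}" using assms(2) by (auto simp: polytope3_def)
  then have "3 \<le> aff_dim (P + Q)" using aff_dim_plus_ge[of Q P] assms(1) by (simp add: polytope3_def)
  moreover have "aff_dim (P + Q) \<le> 3" using aff_dim_le_DIM[of "P + Q"] by simp
  ultimately show ?thesis using assms by (simp add: polytope3_def polytope_plus)
qed

text \<open>In the direction of a facet normal of one summand, the face of the sum contains a
  translate of that facet, and no nonzero direction gives a face of dimension above 2.\<close>

lemma normals_plus:
  assumes P: "polytope3 P" and Q: "polytope3 Q"
  shows "normals P \<union> normals Q \<subseteq> normals (P + Q)"
proof -
  have "normals A \<subseteq> normals (A + B)" if A: "polytope3 A" and B: "polytope3 B" for A B
  proof
    fix a assume a: "a \<in> normals A"
    have "mface B a \<noteq> {}" using B by (intro mface_nonempty) (auto simp: polytope3_def)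
    then have "2 \<le> aff_dim (mface (A + B) a)"
      using aff_dim_plus_ge[of "mface B a" "mface A a"] a by (simp add: mface_plus normals_def)
    moreover have "a \<noteq> 0" using a by (auto simp: normals_def)
    ultimately show "a \<in> normals (A + B)"
      using aff_dim_mface_le[of a "A + B"] a by (simp add: normals_def)
  qed
  then show ?thesis using P Q by (metis Un_subset_iff add.commute)
qed

section \<open>Facets of the sum that stem from no facet of a summand\<close>

lemma aff_dim_1_subset_line:
  fixes F :: "'a::euclidean_space set"
  assumes "aff_dim F = 1"
  obtains p u where "u \<noteq> 0" "F \<subseteq> range (\<lambda>t. p + t *\<^sub>R u)"
proof -
  have "F \<noteq> {}" using assms by auto
  then obtain p where p: "p \<in> F" by blast
  moreover have "F \<noteq> {p}" using assms by auto
  ultimately obtain q where q: "q \<in> F" "q \<noteq> p" by blast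
  have "collinear F" using assms by (simp add: collinear_aff_dim)
  then obtain u where u: "\<And>x y. x \<in> F \<Longrightarrow> y \<in> F \<Longrightarrow> \<exists>c. x - y = c *\<^sub>R u" by (auto simp: collinear_def)
  have "F \<subseteq> range (\<lambda>t. p + t *\<^sub>R u)"
  proof
    fix x assume "x \<in> F"
    then obtain c where "x - p = c *\<^sub>R u" using u p by blast
    then have "x = p + c *\<^sub>R u" by (simp add: algebra_simps)
    then show "x \<in> range (\<lambda>t. p + t *\<^sub>R u)" by blast
  qed
  moreover have "u \<noteq> 0" using u[OF q(1) p] q(2) by auto
  ultimately show thesis using that by blast
qed

text \<open>Dimension 2 forces both summands to be segments, and these cannot be parallel. Addition
  is then injective on \<open>A \<times> B\<close>, so each of the 2 * 2 sums of end points is a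
  vertex.\<close>

lemma parallelogram_vertices:
  fixes A B :: "'a::euclidean_space set"
  assumes "polytope A" "polytope B" "aff_dim A \<le> 1" "aff_dim B \<le> 1" and AB: "aff_dim (A + B) = 2"
  shows "4 \<le> num_faces 0 (A + B)"
proof -
  have point: False if "aff_dim A \<le> 0" "aff_dim B \<le> 1" "aff_dim (A + B) = 2" for A B :: "'a set"
  proof -
    have "A \<noteq> {}" using that(3) by auto
    then have "0 \<le> aff_dim A" using aff_dim_negative_iff[of A] by linarith
    with that(1) have "aff_dim A = 0" by simp
    then obtain p where "A = {p}" using aff_dim_eq_0[of A] by blast
    then have "A + B = (+) p ` B" by (auto simp: set_plus_def)
    then show False using that by (simp add: aff_dim_translation_eq)
  qed
  have "\<not> aff_dim A \<le> 0" using point[of A B] assms by blast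
  then have dA: "aff_dim A = 1" using assms by linarith
  have "\<not> aff_dim B \<le> 0" using point[of B A] assms by (metis add.commute)
  then have dB: "aff_dim B = 1" using assms by linarith
  obtain p u where pu: "u \<noteq> 0" "A \<subseteq> range (\<lambda>t. p + t *\<^sub>R u)" by (rule aff_dim_1_subset_line[OF dA])
  obtain q v where qv: "v \<noteq> 0" "B \<subseteq> range (\<lambda>t. q + t *\<^sub>R v)" by (rule aff_dim_1_subset_line[OF dB])
  have indep: "v \<noteq> k *\<^sub>R u" for k
  proof
    assume v: "v = k *\<^sub>R u"
    have line: "\<exists>c. x = p + q + c *\<^sub>R u" if x: "x \<in> A + B" for x
    proof -
      obtain a b where ab: "a \<in> A" "b \<in> B" "x = a + b" using x by (rule set_plus_elim)
      obtain s where "a = p + s *\<^sub>R u" using subsetD[OF pu(2) ab(1)] by (rule rangeE)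
      moreover obtain t where "b = q + t *\<^sub>R v" using subsetD[OF qv(2) ab(2)] by (rule rangeE)
      ultimately have "x = p + q + (s + t * k) *\<^sub>R u" using ab(3) v by (simp add: algebra_simps)
      then show ?thesis by blast
    qed
    have "\<exists>c. x - y = c *\<^sub>R u" if xy: "x \<in> A + B" "y \<in> A + B" for x y
    proof -
      obtain c c' where "x = p + q + c *\<^sub>R u" "y = p + q + c' *\<^sub>R u" using line xy by metis
      then have "x - y = (c - c') *\<^sub>R u" by (simp add: algebra_simps)
      then show ?thesis by blast
    qed
    then have "collinear (A + B)" unfolding collinear_def by blast
    then show False using AB by (simp add: collinear_aff_dim)
  qed
  have inj: "inj_on (\<lambda>(x, y). x + y) (A \<times> B)"
  proof (rule inj_onI, clarify)
    fix a b a' b' assume ab: "a \<in> A" "b \<in> B" "a' \<in> A" "b' \<in> B" "a + b = a' + b'"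
    obtain s where s: "a = p + s *\<^sub>R u" using subsetD[OF pu(2) ab(1)] by (rule rangeE)
    obtain s' where s': "a' = p + s' *\<^sub>R u" using subsetD[OF pu(2) ab(3)] by (rule rangeE)
    obtain t where t: "b = q + t *\<^sub>R v" using subsetD[OF qv(2) ab(2)] by (rule rangeE)
    obtain t' where t': "b' = q + t' *\<^sub>R v" using subsetD[OF qv(2) ab(4)] by (rule rangeE)
    have eq: "(t - t') *\<^sub>R v = (s' - s) *\<^sub>R u" using ab(5) unfolding s s' t t' by (simp add: algebra_simps)
    have "t = t'"
    proof (rule ccontr)
      assume "t \<noteq> t'"
      then have "v = (1 / (t - t')) *\<^sub>R ((t - t') *\<^sub>R v)" by simp
      also have "\<dots> = ((s' - s) / (t - t')) *\<^sub>R u" unfolding eq by simp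
      finally show False using indep by blast
    qed
    then have "s = s'" using eq pu(1) by simp
    with \<open>t = t'\<close> show "a = a' \<and> b = b'" using s s' t t' by simp
  qed
  have "2 \<le> num_faces 0 A" "2 \<le> num_faces 0 B"
    using num_faces_0_ge[OF assms(1)] num_faces_0_ge[OF assms(2)] dA dB by linarith+
  then have "2 * 2 \<le> num_faces 0 A * num_faces 0 B" by (rule mult_le_mono)
  also have "\<dots> \<le> num_faces 0 (A + B)" by (rule num_faces_0_plus_inj[OF assms(1,2) inj])
  finally show ?thesis by simp
qed

lemma mixed_facet_vertices_ge_4:
  assumes P: "polytope3 P" and Q: "polytope3 Q"
    and a: "a \<in> normals (P + Q)" "a \<notin> normals P" "a \<notin> normals Q"
  shows "4 \<le> num_faces 0 (mface (P + Q) a)"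
proof -
  have "norm a = 1" using a(1) by (simp add: normals_def)
  then have "a \<noteq> 0" by auto
  then have "aff_dim (mface P a) \<le> 1" "aff_dim (mface Q a) \<le> 1"
    using aff_dim_mface_le[of a P] aff_dim_mface_le[of a Q] a \<open>norm a = 1\<close> by (force simp: normals_def)+
  then show ?thesis
    using parallelogram_vertices[of "mface P a" "mface Q a"] P Q a(1)
    by (simp add: polytope3_def polytope_mface normals_def mface_plus)
qed

theorem minkowski_sum_upper_bound:
  assumes P: "polytope3 P" and Q: "polytope3 Q"
  shows "int (num_faces 2 (P + Q)) \<le>
           int (num_faces 0 P) * int (num_faces 0 Q) + int (num_faces 0 P) + int (num_faces 0 Q) - 6"
    and "int (num_faces 1 (P + Q)) \<le>
           2 * int (num_faces 0 P) * int (num_faces 0 Q) + int (num_faces 0 P) + int (num_faces 0 Q) - 8"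
proof -
  note PQ = polytope3_plus[OF P Q]
  let ?N = "normals (P + Q)" and ?M = "normals P \<union> normals Q"
  have fin: "finite ?N" by (rule finite_normals[OF PQ])
  have sub: "?M \<subseteq> ?N" by (rule normals_plus[OF P Q])
  then have finM: "finite ?M" using fin finite_subset by blast
  have "4 * card (?N - ?M) + 3 * card ?M = (\<Sum>a\<in>?N - ?M. 4) + (\<Sum>a\<in>?M. 3)" by simp
  also have "\<dots> \<le> (\<Sum>a\<in>?N - ?M. num_faces 0 (mface (P + Q) a)) + (\<Sum>a\<in>?M. num_faces 0 (mface (P + Q) a))"
  proof (intro add_mono sum_mono)
    show "4 \<le> num_faces 0 (mface (P + Q) a)" if "a \<in> ?N - ?M" for a
      using mixed_facet_vertices_ge_4[OF P Q] that by blast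
    show "3 \<le> num_faces 0 (mface (P + Q) a)" if "a \<in> ?M" for a
      using facet_vertices_ge_3[OF PQ] sub that by blast
  qed
  also have "\<dots> = (\<Sum>a\<in>?N. num_faces 0 (mface (P + Q) a))"
    by (rule sum.subset_diff[OF sub fin, symmetric])
  also have "\<dots> = 2 * num_faces 1 (P + Q)" by (rule sum_facet_vertices[OF PQ])
  finally have "4 * card (?N - ?M) + 3 * card ?M \<le> 2 * num_faces 1 (P + Q)" .
  moreover have "card ?N = card (?N - ?M) + card ?M"
    using card_Diff_subset[OF finM sub] card_mono[OF fin sub] by simp
  moreover have "card ?M \<le> num_faces 2 P + num_faces 2 Q"
    using card_Un_le[of "normals P" "normals Q"] by (simp add: card_normals P Q)
  ultimately have "4 * num_faces 2 (P + Q) \<le> 2 * num_faces 1 (P + Q) + num_faces 2 P + num_faces 2 Q"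
    using card_normals[OF PQ] by linarith
  moreover have "int (num_faces 0 (P + Q)) \<le> int (num_faces 0 P) * int (num_faces 0 Q)"
    using num_faces_0_plus_le[of P Q] P Q unfolding polytope3_def by (metis of_nat_le_iff of_nat_mult)
  ultimately show "int (num_faces 2 (P + Q)) \<le>
      int (num_faces 0 P) * int (num_faces 0 Q) + int (num_faces 0 P) + int (num_faces 0 Q) - 6"
    and "int (num_faces 1 (P + Q)) \<le>
      2 * int (num_faces 0 P) * int (num_faces 0 Q) + int (num_faces 0 P) + int (num_faces 0 Q) - 8"
    using euler_polytope3[OF PQ] num_faces_2_le[OF P] num_faces_2_le[OF Q] by linarith+
qed

text \<open>Each assumption turns one estimate behind the upper bound into an equality:
  \<open>vertices\<close> the count f0 <= nm, \<open>disjoint\<close> the count of normals of the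
  summands, \<open>le_4\<close> and \<open>le_3\<close> the facet sizes, \<open>simplicial\<close>
  the bounds on the facets of each summand. Together with the upper bound the reversed inequalities
  give equality.\<close>

theorem minkowski_sum_tight:
  assumes P: "polytope3 P" and Q: "polytope3 Q"
    and vertices: "num_faces 0 (P + Q) = num_faces 0 P * num_faces 0 Q"
    and disjoint: "normals P \<inter> normals Q = {}"
    and le_4: "\<And>a. a \<in> normals (P + Q) \<Longrightarrow> num_faces 0 (mface (P + Q) a) \<le> 4"
    and simplicial: "\<And>a. a \<in> normals P \<Longrightarrow> num_faces 0 (mface P a) = 3"
      "\<And>a. a \<in> normals Q \<Longrightarrow> num_faces 0 (mface Q a) = 3"
    and le_3: "\<And>a. a \<in> normals P \<union> normals Q \<Longrightarrow> num_faces 0 (mface (P + Q) a) \<le> 3"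
  shows "int (num_faces 2 (P + Q)) =
           int (num_faces 0 P) * int (num_faces 0 Q) + int (num_faces 0 P) + int (num_faces 0 Q) - 6"
    and "int (num_faces 1 (P + Q)) =
           2 * int (num_faces 0 P) * int (num_faces 0 Q) + int (num_faces 0 P) + int (num_faces 0 Q) - 8"
proof -
  note PQ = polytope3_plus[OF P Q]
  let ?N = "normals (P + Q)" and ?M = "normals P \<union> normals Q"
  have fin: "finite ?N" by (rule finite_normals[OF PQ])
  have sub: "?M \<subseteq> ?N" by (rule normals_plus[OF P Q])
  then have finM: "finite ?M" using fin finite_subset by blast
  have "2 * num_faces 1 (P + Q) = (\<Sum>a\<in>?N. num_faces 0 (mface (P + Q) a))"
    by (rule sum_facet_vertices[OF PQ, symmetric])
  also have "\<dots> = (\<Sum>a\<in>?N - ?M. num_faces 0 (mface (P + Q) a)) + (\<Sum>a\<in>?M. num_faces 0 (mface (P + Q) a))"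
    by (rule sum.subset_diff[OF sub fin])
  also have "\<dots> \<le> (\<Sum>a\<in>?N - ?M. 4) + (\<Sum>a\<in>?M. 3)"
    by (intro add_mono sum_mono) (use le_4 le_3 in blast)+
  also have "\<dots> = 4 * card (?N - ?M) + 3 * card ?M" by simp
  finally have "2 * num_faces 1 (P + Q) \<le> 4 * card (?N - ?M) + 3 * card ?M" .
  moreover have "card ?N = card (?N - ?M) + card ?M"
    using card_Diff_subset[OF finM sub] card_mono[OF fin sub] by simp
  moreover have "card ?M = num_faces 2 P + num_faces 2 Q"
    using card_Un_disjoint[OF _ _ disjoint] by (simp add: card_normals finite_normals P Q)
  ultimately have "2 * num_faces 1 (P + Q) + num_faces 2 P + num_faces 2 Q \<le> 4 * num_faces 2 (P + Q)"
    using card_normals[OF PQ] by linarith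
  moreover have "int (num_faces 0 (P + Q)) = int (num_faces 0 P) * int (num_faces 0 Q)"
    using vertices by simp
  moreover have "int (num_faces 2 P) = 2 * int (num_faces 0 P) - 4"
    "int (num_faces 2 Q) = 2 * int (num_faces 0 Q) - 4"
    by (simp_all only: num_faces_2_simplicial[OF P simplicial(1)] num_faces_2_simplicial[OF Q simplicial(2)])
  ultimately show "int (num_faces 2 (P + Q)) =
      int (num_faces 0 P) * int (num_faces 0 Q) + int (num_faces 0 P) + int (num_faces 0 Q) - 6"
    and "int (num_faces 1 (P + Q)) =
      2 * int (num_faces 0 P) * int (num_faces 0 Q) + int (num_faces 0 P) + int (num_faces 0 Q) - 8"
    using euler_polytope3[OF PQ] minkowski_sum_upper_bound[OF P Q] by linarith+
qed

section \<open>Counting the vertices of faces of convex hulls\<close>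

lemma num_faces_0_le_2:
  fixes F :: "'a::euclidean_space set"
  assumes "polytope F" "aff_dim F \<le> 1"
  shows "num_faces 0 F \<le> 2"
proof -
  consider "aff_dim F < 0" | "aff_dim F = int 0" | "aff_dim F = int 1" using assms(2) by fastforce
  then show ?thesis
  proof cases
    case 1
    then have "vertices F = {}" using vertices_subset[of F] by simp
    then show ?thesis by (simp add: num_faces_0)
  next
    case 2
    then show ?thesis using num_faces_full_dim[OF assms(1)] by simp
  next
    case 3
    then show ?thesis using num_faces_full_dim[OF assms(1) 3] euler_num_faces[OF assms(1) 3] by simp
  qed
qed

lemma vertices_hull_subset: "vertices (convex hull V) \<subseteq> V"
  by (auto simp: vertices_def intro: extreme_point_of_convex_hull)

lemma vertices_mface_hull_subset:
  fixes V :: "'a::euclidean_space set"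
  shows "vertices (mface (convex hull V) a) \<subseteq> V \<inter> mface (convex hull V) a"
  using vertices_face[OF mface_face_of[of "convex hull V" a]] vertices_hull_subset[of V] by auto

lemma mface_hull_unique:
  fixes V :: "'a::euclidean_space set"
  assumes V: "finite V" "v \<in> V" and max: "\<And>w. w \<in> V \<Longrightarrow> w \<noteq> v \<Longrightarrow> a \<bullet> w < a \<bullet> v"
  shows "mface (convex hull V) a = {v}"
proof -
  let ?F = "mface (convex hull V) a"
  have pF: "polytope ?F" using V by (intro polytope_mface polytope_convex_hull)
  have "convex hull V \<noteq> {}" using V by auto
  then have "?F \<noteq> {}" using V by (intro mface_nonempty polytope_convex_hull)
  then have "vertices ?F \<noteq> {}" using vertices_nonempty[OF pF] by blast
  moreover have "w = v" if "w \<in> vertices ?F" for w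
  proof (rule ccontr)
    assume "w \<noteq> v"
    have w: "w \<in> V" "w \<in> ?F" using that vertices_mface_hull_subset by blast+
    have "v \<in> convex hull V" using V by (simp add: hull_inc)
    then have "a \<bullet> v \<le> a \<bullet> w" using w(2) by (simp add: mface_def)
    then show False using max[OF w(1) \<open>w \<noteq> v\<close>] by simp
  qed
  ultimately have "vertices ?F = {v}" by blast
  then show ?thesis using polytope_eq_hull_vertices[OF pF] by simp
qed

section \<open>Perturbed parabolas\<close>

text \<open>Vieta's formulas for \<beta> X^3 + \<gamma> X^2 + \<alpha> X - b, obtained from divided
  differences so that they also hold for \<beta> = 0.\<close>

lemma cubic_three_roots:
  fixes \<alpha> \<beta> \<gamma> b x y z :: real
  assumes "x \<noteq> y" "x \<noteq> z" "y \<noteq> z"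
    and "\<alpha> * x + \<beta> * x ^ 3 + \<gamma> * x\<^sup>2 = b" "\<alpha> * y + \<beta> * y ^ 3 + \<gamma> * y\<^sup>2 = b"
      "\<alpha> * z + \<beta> * z ^ 3 + \<gamma> * z\<^sup>2 = b"
  shows "\<gamma> = - \<beta> * (x + y + z)" "\<alpha> = \<beta> * (x * y + y * z + z * x)"
proof -
  have div: "\<alpha> + \<beta> * (s\<^sup>2 + s * t + t\<^sup>2) + \<gamma> * (s + t) = 0"
    if "s \<noteq> t" "\<alpha> * s + \<beta> * s ^ 3 + \<gamma> * s\<^sup>2 = b" "\<alpha> * t + \<beta> * t ^ 3 + \<gamma> * t\<^sup>2 = b" for s t
  proof -
    have "(s - t) * (\<alpha> + \<beta> * (s\<^sup>2 + s * t + t\<^sup>2) + \<gamma> * (s + t)) =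
        (\<alpha> * s + \<beta> * s ^ 3 + \<gamma> * s\<^sup>2) - (\<alpha> * t + \<beta> * t ^ 3 + \<gamma> * t\<^sup>2)"
      by (simp add: algebra_simps power2_eq_square power3_eq_cube)
    then show ?thesis using that by simp
  qed
  have xy: "\<alpha> + \<beta> * (x\<^sup>2 + x * y + y\<^sup>2) + \<gamma> * (x + y) = 0" using div[of x y] assms by simp
  have xz: "\<alpha> + \<beta> * (x\<^sup>2 + x * z + z\<^sup>2) + \<gamma> * (x + z) = 0" using div[of x z] assms by simp
  have "(y - z) * (\<beta> * (x + y + z) + \<gamma>) =
      (\<alpha> + \<beta> * (x\<^sup>2 + x * y + y\<^sup>2) + \<gamma> * (x + y)) - (\<alpha> + \<beta> * (x\<^sup>2 + x * z + z\<^sup>2) + \<gamma> * (x + z))"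
    by (simp add: algebra_simps power2_eq_square)
  then show \<gamma>: "\<gamma> = - \<beta> * (x + y + z)" using xy xz assms(3) by simp
  show "\<alpha> = \<beta> * (x * y + y * z + z * x)"
    using xy unfolding \<gamma> by (simp add: algebra_simps power2_eq_square)
qed

text \<open>Swapping \<open>u\<close> and \<open>v\<close> gives two parabolas in orthogonal planes, bent slightly into moment curves
  so that the polytopes become full-dimensional and simplicial.\<close>
definition curve :: "3 \<Rightarrow> 3 \<Rightarrow> real \<Rightarrow> nat \<Rightarrow> real^3" where
  "curve u v \<epsilon> i = real i *\<^sub>R axis u 1 + (\<epsilon> * real i ^ 3) *\<^sub>R axis v 1 + (real i)\<^sup>2 *\<^sub>R axis 3 1"

definition curve_hull :: "3 \<Rightarrow> 3 \<Rightarrow> real \<Rightarrow> nat \<Rightarrow> (real^3) set" where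
  "curve_hull u v \<epsilon> n = convex hull (curve u v \<epsilon> ` {..<n})"

text \<open>A linear functional along the curve is a cubic in \<open>i\<close>, so questions on
  coplanar points become questions on roots.\<close>

lemma inner_curve:
  "a \<bullet> curve u v \<epsilon> i = a $ u * real i + (\<epsilon> * a $ v) * real i ^ 3 + a $ 3 * (real i)\<^sup>2"
  by (simp add: curve_def inner_add_right inner_axis)

lemma curve_hull_in:
  "i < n \<Longrightarrow> curve u v \<epsilon> i \<in> curve_hull u v \<epsilon> n"
  by (simp add: curve_hull_def hull_inc)

lemma polytope_curve_hull: "polytope (curve_hull u v \<epsilon> n)"
  by (simp add: curve_hull_def polytope_convex_hull)

lemma vertices_mface_curve_hull:
  obtains b where "vertices (mface (curve_hull u v \<epsilon> n) a) \<subseteq> curve u v \<epsilon> ` {i. i < n \<and> a \<bullet> curve u v \<epsilon> i = b}"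
proof (cases "mface (curve_hull u v \<epsilon> n) a = {}")
  case True
  then show thesis using that vertices_subset by blast
next
  case False
  then obtain x where "x \<in> mface (curve_hull u v \<epsilon> n) a" by blast
  then have "mface (curve_hull u v \<epsilon> n) a \<subseteq> {y. a \<bullet> y = a \<bullet> x}" using mface_eq_slice by blast
  then show thesis
    using that[of "a \<bullet> x"] vertices_mface_hull_subset[of "curve u v \<epsilon> ` {..<n}" a]
    unfolding curve_hull_def by blast
qed

context
  fixes u v :: 3 and \<epsilon> :: real
  assumes uv: "u = 1 \<and> v = 2 \<or> u = 2 \<and> v = 1" and eps: "0 < \<epsilon>"
begin

lemma vec_zero_iff: "(a :: real^3) = 0 \<longleftrightarrow> a $ u = 0 \<and> a $ v = 0 \<and> a $ 3 = 0"
  using uv by (auto simp: vec_eq_iff forall_3)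

text \<open>Two triples of roots sharing two members have different sums, so Vieta's formula for the
  quadratic coefficient forces the cubic one to vanish, and then the others.\<close>

lemma curve_four_coplanar:
  assumes "\<And>i. i \<in> I \<Longrightarrow> a \<bullet> curve u v \<epsilon> i = b" and I: "finite I" "4 \<le> card I"
  shows "a = 0"
proof -
  obtain J where J: "J \<subseteq> I" "card J = 4" using I obtain_subset_with_card_n by metis
  then obtain i where i: "i \<in> J" by fastforce
  moreover have "finite J" using J I finite_subset by blast
  ultimately have "card (J - {i}) = 3" using J by simp
  then obtain j k l where jkl: "J - {i} = {j, k, l}" "j \<noteq> k" "k \<noteq> l" "j \<noteq> l"
    using card_3_iff by metis
  have eq: "a $ u * real m + (\<epsilon> * a $ v) * real m ^ 3 + a $ 3 * (real m)\<^sup>2 = b" if "m \<in> {i, j, k, l}" for m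
    using assms(1)[of m] that J i jkl unfolding inner_curve by blast
  have ne: "real i \<noteq> real j" "real i \<noteq> real k" "real i \<noteq> real l" "real j \<noteq> real k" "real k \<noteq> real l" "real j \<noteq> real l"
    using jkl by auto
  note A = cubic_three_roots[OF ne(1,2,4) eq eq eq] and B = cubic_three_roots[OF ne(1,3,6) eq eq eq]
  have "\<epsilon> * a $ v * (real k - real l) = 0" using A(1) B(1) by (simp add: algebra_simps)
  then have "a $ v = 0" using ne eps by simp
  then show ?thesis using A by (simp add: vec_zero_iff)
qed

lemma polytope3_curve_hull:
  assumes "4 \<le> n"
  shows "polytope3 (curve_hull u v \<epsilon> n)"
proof -
  let ?P = "curve_hull u v \<epsilon> n"
  have "\<not> aff_dim ?P < DIM(real^3)"
  proof
    assume "aff_dim ?P < DIM(real^3)"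
    then obtain a b where a: "a \<noteq> 0" "?P \<subseteq> {x. a \<bullet> x = b}"
      by (rule aff_lowdim_subset_hyperplane)
    then have "a \<bullet> curve u v \<epsilon> i = b" if "i \<in> {..<n}" for i
      using curve_hull_in[of i n u v \<epsilon>] that by blast
    then show False using curve_four_coplanar[of "{..<n}" a b] a(1) assms by simp
  qed
  then show ?thesis using aff_dim_le_DIM[of ?P] by (simp add: polytope3_def polytope_curve_hull)
qed

lemma mface_curve_hull_le_3:
  assumes "a \<noteq> 0"
  shows "num_faces 0 (mface (curve_hull u v \<epsilon> n) a) \<le> 3"
proof -
  obtain b where b: "vertices (mface (curve_hull u v \<epsilon> n) a) \<subseteq> curve u v \<epsilon> ` {i. i < n \<and> a \<bullet> curve u v \<epsilon> i = b}"
    by (rule vertices_mface_curve_hull)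
  let ?I = "{i. i < n \<and> a \<bullet> curve u v \<epsilon> i = b}"
  have "\<not> 4 \<le> card ?I" using curve_four_coplanar[of ?I a b] assms by auto
  moreover have "card (vertices (mface (curve_hull u v \<epsilon> n) a)) \<le> card ?I"
    using b by (intro surj_card_le) auto
  ultimately show ?thesis by (simp add: num_faces_0)
qed

lemma facet_curve_hull_3:
  assumes "4 \<le> n" "a \<in> normals (curve_hull u v \<epsilon> n)"
  shows "num_faces 0 (mface (curve_hull u v \<epsilon> n) a) = 3"
proof -
  have "a \<noteq> 0" using assms(2) by (auto simp: normals_def)
  then show ?thesis
    using facet_vertices_ge_3[OF polytope3_curve_hull[OF assms(1)] assms(2)] mface_curve_hull_le_3[of a n] by simp
qed

text \<open>The three vertices of a facet are roots of one cubic. By Vieta both other coordinates of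
  the normal are \<epsilon> times a multiple of \<open>a $ v\<close>, so for small \<epsilon> the
  normal is nearly parallel to axis \<open>v\<close>.\<close>

lemma curve_facet_coefficients:
  assumes n: "4 \<le> n" and a: "a \<in> normals (curve_hull u v \<epsilon> n)"
  obtains x y z where "x < n" "y < n" "z < n"
    "a $ 3 = - (\<epsilon> * a $ v) * (real x + real y + real z)"
    "a $ u = \<epsilon> * a $ v * (real x * real y + real y * real z + real z * real x)"
proof -
  obtain b where b: "vertices (mface (curve_hull u v \<epsilon> n) a) \<subseteq> curve u v \<epsilon> ` {i. i < n \<and> a \<bullet> curve u v \<epsilon> i = b}"
    by (rule vertices_mface_curve_hull)
  let ?I = "{i. i < n \<and> a \<bullet> curve u v \<epsilon> i = b}"
  have "card (vertices (mface (curve_hull u v \<epsilon> n) a)) \<le> card ?I"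
    using b by (intro surj_card_le) auto
  then have "3 \<le> card ?I" using facet_curve_hull_3[OF n a] by (simp add: num_faces_0)
  then obtain J where J: "J \<subseteq> ?I" "card J = 3" by (rule obtain_subset_with_card_n)
  then obtain x y z where xyz: "J = {x, y, z}" "x \<noteq> y" "y \<noteq> z" "x \<noteq> z"
    using card_3_iff by metis
  then have m: "x \<in> ?I" "y \<in> ?I" "z \<in> ?I" using J by blast+
  have eq: "a $ u * real m + (\<epsilon> * a $ v) * real m ^ 3 + a $ 3 * (real m)\<^sup>2 = b" if "m \<in> ?I" for m
    using that unfolding inner_curve by blast
  have ne: "real x \<noteq> real y" "real x \<noteq> real z" "real y \<noteq> real z" using xyz by auto
  show thesis
    using that[of x y z] m cubic_three_roots[OF ne eq[OF m(1)] eq[OF m(2)] eq[OF m(3)]] by blast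
qed

text \<open>The normal is almost parallel to axis \<open>v\<close>, along which the swapped curve
  advances by one per step. The perturbation is too small to give two of its points equal height, so
  the maximum is attained at a single vertex.\<close>

lemma opposite_mface_le_1:
  assumes n: "4 \<le> n" "n \<le> N" "m \<le> N" and small: "7 * real N ^ 4 * \<epsilon> \<le> 1"
    and a: "a \<in> normals (curve_hull u v \<epsilon> n)"
  shows "num_faces 0 (mface (curve_hull v u \<epsilon> m) a) \<le> 1"
proof -
  obtain x y z where xyz: "x < n" "y < n" "z < n"
    and a3: "a $ 3 = - (\<epsilon> * a $ v) * (real x + real y + real z)"
    and au: "a $ u = \<epsilon> * a $ v * (real x * real y + real y * real z + real z * real x)"
    by (rule curve_facet_coefficients[OF n(1) a])
  have N: "1 \<le> real N" using n by simp
  have av: "a $ v \<noteq> 0"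
  proof
    assume "a $ v = 0"
    then have "a = 0" using a3 au by (simp add: vec_zero_iff)
    then show False using a by (simp add: normals_def)
  qed
  have ne: "a \<bullet> curve v u \<epsilon> j \<noteq> a \<bullet> curve v u \<epsilon> k" if jk: "j < m" "k < m" "j \<noteq> k" for j k
  proof
    assume eq: "a \<bullet> curve v u \<epsilon> j = a \<bullet> curve v u \<epsilon> k"
    let ?j = "real j" and ?k = "real k"
    let ?e1 = "real x + real y + real z" and ?e2 = "real x * real y + real y * real z + real z * real x"
    \<comment> \<open>The difference of heights is divided by \<open>?j - ?k\<close>; after
      inserting the coefficients of the normal and dividing by \<open>a $ v\<close>, it remains to
      see that 1, plus a nonnegative term, minus a term below 1 is not zero.\<close>
    have "(?j - ?k) * (a $ v + \<epsilon> * a $ u * (?j\<^sup>2 + ?j * ?k + ?k\<^sup>2) + a $ 3 * (?j + ?k)) =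
        a \<bullet> curve v u \<epsilon> j - a \<bullet> curve v u \<epsilon> k"
      unfolding inner_curve by (simp add: algebra_simps power2_eq_square power3_eq_cube)
    then have "a $ v + \<epsilon> * a $ u * (?j\<^sup>2 + ?j * ?k + ?k\<^sup>2) + a $ 3 * (?j + ?k) = 0"
      using eq jk(3) by simp
    then have "a $ v * (1 + \<epsilon>\<^sup>2 * ?e2 * (?j\<^sup>2 + ?j * ?k + ?k\<^sup>2) - \<epsilon> * (?e1 * (?j + ?k))) = 0"
      unfolding a3 au by (simp add: algebra_simps power2_eq_square)
    then have "1 + \<epsilon>\<^sup>2 * ?e2 * (?j\<^sup>2 + ?j * ?k + ?k\<^sup>2) - \<epsilon> * (?e1 * (?j + ?k)) = 0"
      using av by simp
    moreover have "0 \<le> \<epsilon>\<^sup>2 * ?e2 * (?j\<^sup>2 + ?j * ?k + ?k\<^sup>2)" by simp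
    moreover have "\<epsilon> * (?e1 * (?j + ?k)) < 1"
    proof -
      have "?e1 * (?j + ?k) \<le> (3 * real N) * (2 * real N)"
        using xyz jk n by (intro mult_mono) auto
      also have "\<dots> = 6 * real N ^ 2" by (simp add: power2_eq_square)
      also have "\<dots> \<le> 6 * real N ^ 4" using N by (intro mult_left_mono power_increasing) auto
      also have "\<dots> < 7 * real N ^ 4" using N by simp
      finally have "\<epsilon> * (?e1 * (?j + ?k)) < \<epsilon> * (7 * real N ^ 4)" using eps by (intro mult_strict_left_mono)
      then show ?thesis using small by (simp add: mult.commute)
    qed
    ultimately show False by linarith
  qed
  obtain b where b: "vertices (mface (curve_hull v u \<epsilon> m) a) \<subseteq> curve v u \<epsilon> ` {i. i < m \<and> a \<bullet> curve v u \<epsilon> i = b}"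
    by (rule vertices_mface_curve_hull)
  let ?I = "{i. i < m \<and> a \<bullet> curve v u \<epsilon> i = b}"
  have "card (vertices (mface (curve_hull v u \<epsilon> m) a)) \<le> card ?I"
    using b by (intro surj_card_le) auto
  moreover have "card ?I \<le> 1" using ne by (intro card_le_Suc0_iff_eq[THEN iffD2, folded One_nat_def]) auto
  ultimately show ?thesis by (simp add: num_faces_0)
qed

end

text \<open>As 2ij - j^2 = i^2 - (i - j)^2, any integer \<open>j\<close> other than \<open>i\<close>
  loses at least 1, while the cubic term gains less than 1. The factor 7 in the smallness condition
  is chosen to exceed strictly both the 2 needed here and the 6 needed for facet normals.\<close>

lemma perturbed_parabola_max:
  fixes \<epsilon> :: real
  assumes "i < N" "k < N" "j < N" "j \<noteq> i" and \<epsilon>: "0 < \<epsilon>" "7 * real N ^ 4 * \<epsilon> \<le> 1"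
  shows "2 * real i * real j + (\<epsilon> * (2 * real k)) * real j ^ 3 - (real j)\<^sup>2
    < 2 * real i * real i + (\<epsilon> * (2 * real k)) * real i ^ 3 - (real i)\<^sup>2"
proof -
  have "1 \<le> \<bar>real i - real j\<bar>" using assms(4) by linarith
  then have "1 \<le> (real i - real j)\<^sup>2" by (metis abs_ge_zero one_le_power power2_abs)
  moreover have "\<epsilon> * (2 * real k) * real j ^ 3 < 1"
  proof -
    have "(2 * real k) * real j ^ 3 \<le> (2 * real N) * real N ^ 3"
      using assms by (intro mult_mono power_mono) auto
    also have "\<dots> = 2 * real N ^ 4" by (simp add: power_numeral_reduce)
    also have "\<dots> < 7 * real N ^ 4" using assms by simp
    finally have "\<epsilon> * ((2 * real k) * real j ^ 3) < \<epsilon> * (7 * real N ^ 4)"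
      using \<epsilon>(1) by (rule mult_strict_left_mono)
    then show ?thesis using \<epsilon>(2) by (simp add: mult.commute mult.left_commute)
  qed
  moreover have "0 \<le> \<epsilon> * (2 * real k) * real i ^ 3" using \<epsilon>(1) by simp
  ultimately show ?thesis by (simp add: power2_eq_square algebra_simps)
qed

section \<open>Vertices singled out by a direction\<close>

context
  fixes u v :: 3 and \<epsilon> :: real and N :: nat
  assumes uv: "u = 1 \<and> v = 2 \<or> u = 2 \<and> v = 1"
    and eps: "0 < \<epsilon>" "7 * real N ^ 4 * \<epsilon> \<le> 1"
begin

text \<open>For \<open>\<epsilon> = 0\<close> the heights of the two parabolas along this direction are independent quadratics
  in \<open>i\<close> and \<open>k\<close>, so one direction selects a vertex of each summand.\<close>
lemma curve_tangent_max:
  assumes "i < N" "k < N" "j < N" "j \<noteq> i"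
    and a: "a $ u = 2 * real i" "a $ v = 2 * real k" "a $ 3 = - 1"
  shows "a \<bullet> curve u v \<epsilon> j < a \<bullet> curve u v \<epsilon> i"
  using perturbed_parabola_max[OF assms(1-4) eps] unfolding inner_curve a by simp

lemma mface_curve_tangent:
  assumes "i < n" "n \<le> N" "k < N"
    and a: "a $ u = 2 * real i" "a $ v = 2 * real k" "a $ 3 = - 1"
  shows "mface (curve_hull u v \<epsilon> n) a = {curve u v \<epsilon> i}"
  unfolding curve_hull_def
proof (rule mface_hull_unique)
  fix w assume "w \<in> curve u v \<epsilon> ` {..<n}" "w \<noteq> curve u v \<epsilon> i"
  then obtain j where "j < n" "w = curve u v \<epsilon> j" "j \<noteq> i" by blast
  then show "a \<bullet> w < a \<bullet> curve u v \<epsilon> i" using curve_tangent_max[of i k j a] assms by simp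
qed (use assms in auto)

lemma exists_tangent_direction:
  obtains a :: "real^3" where "a $ u = r" "a $ v = s" "a $ 3 = t"
proof
  let ?a = "\<chi> m. if m = u then r else if m = v then s else t"
  show "?a $ u = r" "?a $ v = s" "?a $ 3 = t" using uv by auto
qed

lemma inj_on_curve: "inj_on (curve u v \<epsilon>) {..<N}"
proof (rule inj_onI, rule ccontr)
  fix i j assume ij: "i \<in> {..<N}" "j \<in> {..<N}" "curve u v \<epsilon> i = curve u v \<epsilon> j" "i \<noteq> j"
  obtain a :: "real^3" where "a $ u = 2 * real i" "a $ v = 2 * real 0" "a $ 3 = - 1"
    by (rule exists_tangent_direction)
  then have "a \<bullet> curve u v \<epsilon> j < a \<bullet> curve u v \<epsilon> i" using ij by (intro curve_tangent_max[of i 0 j]) auto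
  then show False using ij(3) by simp
qed

lemma num_vertices_curve_hull:
  assumes "n \<le> N"
  shows "num_faces 0 (curve_hull u v \<epsilon> n) = n"
proof -
  let ?P = "curve_hull u v \<epsilon> n"
  have "curve u v \<epsilon> i \<in> vertices ?P" if i: "i < n" for i
  proof -
    obtain a :: "real^3" where "a $ u = 2 * real i" "a $ v = 2 * real 0" "a $ 3 = - 1"
      by (rule exists_tangent_direction)
    then have "mface ?P a = {curve u v \<epsilon> i}" using i assms by (intro mface_curve_tangent[of i n 0]) auto
    moreover have "mface ?P a face_of ?P"
      by (intro mface_face_of polytope_imp_convex polytope_curve_hull)
    ultimately show ?thesis by (simp add: vertices_def face_of_singleton)
  qed
  moreover have "vertices ?P \<subseteq> curve u v \<epsilon> ` {..<n}" unfolding curve_hull_def by (rule vertices_hull_subset)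
  ultimately have "vertices ?P = curve u v \<epsilon> ` {..<n}" by auto
  moreover have "inj_on (curve u v \<epsilon>) {..<n}" using inj_on_curve assms by (auto intro: inj_on_subset)
  ultimately show ?thesis by (simp add: num_faces_0 card_image)
qed

end

text \<open>For \<epsilon> = 0 the sums (i, j, i^2 + j^2) lie on a paraboloid with outer normal (2i,
  2j, -1). For small \<epsilon> this direction still has a unique maximal point on each summand, so
  their sum is a vertex of the Minkowski sum.\<close>

lemma num_vertices_curve_sum:
  fixes \<epsilon> :: real
  assumes eps: "0 < \<epsilon>" "7 * real N ^ 4 * \<epsilon> \<le> 1" and mn: "m \<le> N" "n \<le> N"
  shows "num_faces 0 (curve_hull 1 2 \<epsilon> m + curve_hull 2 1 \<epsilon> n) = m * n"
proof -
  let ?p = "curve 1 2 \<epsilon>" and ?q = "curve 2 1 \<epsilon>"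
  let ?P = "curve_hull 1 2 \<epsilon> m" and ?Q = "curve_hull 2 1 \<epsilon> n"
  have uv1: "(1::3) = 1 \<and> (2::3) = 2 \<or> (1::3) = 2 \<and> (2::3) = 1" by simp
  have uv2: "(2::3) = 1 \<and> (1::3) = 2 \<or> (2::3) = 2 \<and> (1::3) = 1" by simp
  have face: "\<exists>a. mface ?P a = {?p i} \<and> mface ?Q a = {?q j}" if "i < m" "j < n" for i j
  proof -
    obtain a :: "real^3" where a: "a $ 1 = 2 * real i" "a $ 2 = 2 * real j" "a $ 3 = - 1"
      by (rule exists_tangent_direction[OF uv1 eps])
    then show ?thesis
      using mface_curve_tangent[OF uv1 eps, of i m j a] mface_curve_tangent[OF uv2 eps, of j n i a] that mn
      by auto
  qed
  have pPQ: "polytope (?P + ?Q)" by (intro polytope_plus polytope_curve_hull)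
  let ?s = "\<lambda>(i, j). ?p i + ?q j"
  have "?p i + ?q j \<in> vertices (?P + ?Q)" if ij: "i < m" "j < n" for i j
  proof -
    obtain a where "mface ?P a = {?p i}" "mface ?Q a = {?q j}" using face[OF ij] by blast
    then have "mface (?P + ?Q) a = {?p i + ?q j}" unfolding mface_plus by (simp add: set_plus_def)
    moreover have "mface (?P + ?Q) a face_of (?P + ?Q)"
      by (intro mface_face_of polytope_imp_convex pPQ)
    ultimately show ?thesis by (simp add: vertices_def face_of_singleton)
  qed
  then have sub: "?s ` ({..<m} \<times> {..<n}) \<subseteq> vertices (?P + ?Q)" by auto
  \<comment> \<open>If two pairs had the same sum, the direction selecting the first pair would be
    maximal at both terms of the second, and its maximizers are unique.\<close>
  have "inj_on ?s ({..<m} \<times> {..<n})"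
  proof (rule inj_onI, clarify)
    fix i j i' j' assume ij: "i < m" "j < n" and ij': "i' < m" "j' < n" and eq: "?p i + ?q j = ?p i' + ?q j'"
    obtain a where a: "mface ?P a = {?p i}" "mface ?Q a = {?q j}" using face[OF ij] by blast
    have P': "?p i' \<in> ?P" "?q j' \<in> ?Q" "?p i \<in> ?P" "?q j \<in> ?Q" using ij ij' by (simp_all add: curve_hull_in)
    have max: "a \<bullet> x \<le> a \<bullet> ?p i" "a \<bullet> y \<le> a \<bullet> ?q j" if "x \<in> ?P" "y \<in> ?Q" for x y
    proof -
      have "?p i \<in> mface ?P a" "?q j \<in> mface ?Q a" using a by auto
      then show "a \<bullet> x \<le> a \<bullet> ?p i" "a \<bullet> y \<le> a \<bullet> ?q j" using that by (auto simp: mface_def)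
    qed
    have "a \<bullet> ?p i + a \<bullet> ?q j = a \<bullet> ?p i' + a \<bullet> ?q j'" using eq by (metis inner_add_right)
    then have "a \<bullet> ?p i' = a \<bullet> ?p i" "a \<bullet> ?q j' = a \<bullet> ?q j" using max[OF P'(1,2)] by linarith+
    then have "?p i' \<in> mface ?P a" "?q j' \<in> mface ?Q a" using P' max by (auto simp: mface_def)
    then have "?p i' = ?p i" "?q j' = ?q j" using a by auto
    then show "i = i' \<and> j = j'"
      using inj_onD[OF inj_on_curve[OF uv1 eps]] inj_onD[OF inj_on_curve[OF uv2 eps]] ij ij' mn by auto
  qed
  then have "card (?s ` ({..<m} \<times> {..<n})) = m * n" by (simp add: card_image card_cartesian_product)
  then have "m * n \<le> num_faces 0 (?P + ?Q)"
    using card_mono[OF finite_vertices[OF pPQ] sub] by (simp add: num_faces_0)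
  moreover have "num_faces 0 (?P + ?Q) \<le> m * n"
    using num_faces_0_plus_le[OF polytope_curve_hull polytope_curve_hull, of 1 2 \<epsilon> m 2 1 \<epsilon> n]
      num_vertices_curve_hull[OF uv1 eps mn(1)] num_vertices_curve_hull[OF uv2 eps mn(2)] by simp
  ultimately show ?thesis by simp
qed

theorem minkowski_sum_bound_attained:
  assumes "4 \<le> m" "4 \<le> n"
  obtains P Q where "polytope3 P" "polytope3 Q" "num_faces 0 P = m" "num_faces 0 Q = n"
    "int (num_faces 2 (P + Q)) = int m * int n + int m + int n - 6"
    "int (num_faces 1 (P + Q)) = 2 * int m * int n + int m + int n - 8"
proof -
  define N where "N = max m n"
  define \<epsilon> where "\<epsilon> = 1 / (7 * real N ^ 4)"
  have mn: "m \<le> N" "n \<le> N" and N: "0 < real N" using assms by (auto simp: N_def)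
  have eps: "0 < \<epsilon>" "7 * real N ^ 4 * \<epsilon> \<le> 1" using N by (auto simp: \<epsilon>_def)
  have uv1: "(1::3) = 1 \<and> (2::3) = 2 \<or> (1::3) = 2 \<and> (2::3) = 1" by simp
  have uv2: "(2::3) = 1 \<and> (1::3) = 2 \<or> (2::3) = 2 \<and> (1::3) = 1" by simp
  define P where "P = curve_hull 1 2 \<epsilon> m"
  define Q where "Q = curve_hull 2 1 \<epsilon> n"
  have P: "polytope3 P" unfolding P_def by (rule polytope3_curve_hull[OF uv1 eps(1) assms(1)])
  have Q: "polytope3 Q" unfolding Q_def by (rule polytope3_curve_hull[OF uv2 eps(1) assms(2)])
  have fP: "num_faces 0 P = m" unfolding P_def by (rule num_vertices_curve_hull[OF uv1 eps mn(1)])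
  have fQ: "num_faces 0 Q = n" unfolding Q_def by (rule num_vertices_curve_hull[OF uv2 eps mn(2)])
  have fPQ: "num_faces 0 (P + Q) = num_faces 0 P * num_faces 0 Q"
    unfolding fP fQ unfolding P_def Q_def by (rule num_vertices_curve_sum[OF eps mn])
  have P3: "num_faces 0 (mface P a) = 3" if "a \<in> normals P" for a
    using facet_curve_hull_3[OF uv1 eps(1) assms(1)] that unfolding P_def by blast
  have Q3: "num_faces 0 (mface Q a) = 3" if "a \<in> normals Q" for a
    using facet_curve_hull_3[OF uv2 eps(1) assms(2)] that unfolding Q_def by blast
  have P1: "num_faces 0 (mface Q a) \<le> 1" if "a \<in> normals P" for a
    using opposite_mface_le_1[OF uv1 eps(1) assms(1) mn eps(2)] that unfolding P_def Q_def by blast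
  have Q1: "num_faces 0 (mface P a) \<le> 1" if "a \<in> normals Q" for a
    using opposite_mface_le_1[OF uv2 eps(1) assms(2) mn(2,1) eps(2)] that unfolding P_def Q_def by blast
  have le: "num_faces 0 (mface (P + Q) a) \<le> num_faces 0 (mface P a) * num_faces 0 (mface Q a)" for a
    unfolding mface_plus using P Q by (intro num_faces_0_plus_le polytope_mface) (auto simp: polytope3_def)
  have le_3: "num_faces 0 (mface (P + Q) a) \<le> 3" if "a \<in> normals P \<union> normals Q" for a
  proof (cases "a \<in> normals P")
    case True
    then show ?thesis using le[of a] P1[OF True] unfolding P3[OF True] by linarith
  next
    case False
    then have "a \<in> normals Q" using that by blast
    then show ?thesis using le[of a] Q3[of a] mult_le_mono1[OF Q1[of a], of 3] by simp
  qed
  \<comment> \<open>If \<open>a\<close> is a normal of neither summand, both faces are at most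
    segments, so their sum has at most 2 * 2 vertices.\<close>
  have le_4: "num_faces 0 (mface (P + Q) a) \<le> 4" if a: "a \<in> normals (P + Q)" for a
  proof (cases "a \<in> normals P \<union> normals Q")
    case True
    then show ?thesis using le_3[of a] by simp
  next
    case False
    have "norm a = 1" using a by (simp add: normals_def)
    then have "a \<noteq> 0" by auto
    then have "aff_dim (mface P a) \<le> 1" "aff_dim (mface Q a) \<le> 1"
      using aff_dim_mface_le[of a P] aff_dim_mface_le[of a Q] False \<open>norm a = 1\<close> by (force simp: normals_def)+
    then have "num_faces 0 (mface P a) \<le> 2" "num_faces 0 (mface Q a) \<le> 2"
      using P Q by (auto intro!: num_faces_0_le_2 polytope_mface simp: polytope3_def)
    then have "num_faces 0 (mface P a) * num_faces 0 (mface Q a) \<le> 2 * 2" by (rule mult_le_mono)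
    then show ?thesis using le[of a] by simp
  qed
  \<comment> \<open>In a common normal direction the face of \<open>Q\<close> would have three
    vertices as a facet, but at most one as the face opposite to a facet of
    \<open>P\<close>.\<close>
  have disj: "normals P \<inter> normals Q = {}" using P1 Q3 by fastforce
  note tight = minkowski_sum_tight[OF P Q fPQ disj le_4 P3 Q3 le_3]
  show thesis using that[OF P Q fP fQ] tight unfolding fP fQ by simp
qed

theorem corollary4:
  shows "(\<forall>P1 P2 :: (real^3) set. polytope3 P1 \<and> polytope3 P2 \<longrightarrow>
            int (num_faces 2 (P1 + P2)) \<le>
              int (num_faces 0 P1) * int (num_faces 0 P2) + int (num_faces 0 P1) + int (num_faces 0 P2) - 6 \<and>
            int (num_faces 1 (P1 + P2)) \<le>
              2 * int (num_faces 0 P1) * int (num_faces 0 P2) + int (num_faces 0 P1) + int (num_faces 0 P2) - 8)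
       \<and> (\<forall>n1 n2 :: nat. n1 \<ge> 4 \<and> n2 \<ge> 4 \<longrightarrow>
            (\<exists>P1 P2 :: (real^3) set. polytope3 P1 \<and> polytope3 P2 \<and>
              num_faces 0 P1 = n1 \<and> num_faces 0 P2 = n2 \<and>
              int (num_faces 2 (P1 + P2)) =
                int (num_faces 0 P1) * int (num_faces 0 P2) + int (num_faces 0 P1) + int (num_faces 0 P2) - 6 \<and>
              int (num_faces 1 (P1 + P2)) =
                2 * int (num_faces 0 P1) * int (num_faces 0 P2) + int (num_faces 0 P1) + int (num_faces 0 P2) - 8))"
proof (intro conjI allI impI)
  fix P1 P2 :: "(real^3) set"
  assume "polytope3 P1 \<and> polytope3 P2"
  then have P: "polytope3 P1" "polytope3 P2" by auto
  show "int (num_faces 2 (P1 + P2)) \<le>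
      int (num_faces 0 P1) * int (num_faces 0 P2) + int (num_faces 0 P1) + int (num_faces 0 P2) - 6"
    by (rule minkowski_sum_upper_bound(1)[OF P])
  show "int (num_faces 1 (P1 + P2)) \<le>
      2 * int (num_faces 0 P1) * int (num_faces 0 P2) + int (num_faces 0 P1) + int (num_faces 0 P2) - 8"
    by (rule minkowski_sum_upper_bound(2)[OF P])
next
  fix n1 n2 :: nat
  assume n: "n1 \<ge> 4 \<and> n2 \<ge> 4"
  obtain P1 P2 :: "(real^3) set" where "polytope3 P1" "polytope3 P2" "num_faces 0 P1 = n1" "num_faces 0 P2 = n2"
    "int (num_faces 2 (P1 + P2)) = int n1 * int n2 + int n1 + int n2 - 6"
    "int (num_faces 1 (P1 + P2)) = 2 * int n1 * int n2 + int n1 + int n2 - 8"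
    using minkowski_sum_bound_attained n by metis
  then show "\<exists>P1 P2 :: (real^3) set. polytope3 P1 \<and> polytope3 P2 \<and>
      num_faces 0 P1 = n1 \<and> num_faces 0 P2 = n2 \<and>
      int (num_faces 2 (P1 + P2)) =
        int (num_faces 0 P1) * int (num_faces 0 P2) + int (num_faces 0 P1) + int (num_faces 0 P2) - 6 \<and>
      int (num_faces 1 (P1 + P2)) =
        2 * int (num_faces 0 P1) * int (num_faces 0 P2) + int (num_faces 0 P1) + int (num_faces 0 P2) - 8"
    by blast
qed

end
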